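(* Let $s$ be a composition, $h$ an admissible height function for the DKK triangulation of $\mathcal F_{G_s}$, and $\mathcal P_h$ the associated complex of bounded cells. Then $w\mapsto v(w)$ is a bijection between Stirling $s$-permutations and the vertices of $\mathcal P_h$, and for every Stirling $s$-permutation $w$ and $a\in[n]$, \[ v(w)_a=\sum_{t=1}^{s_a}\Big(h\big(\mathrm{route}(w_{[i(a^t)]})\big)-h\big(\mathrm{route}(w_{[i(a^t)+1]})\big)\Big), \] where $i(a^t)$ is the length of the prefix of $w$ preceding the $t$-th occurrence of $a$.
   Context: $s=(s_1,\dots,s_n)$ is a composition; $|s|=\sum s_i$. Stirling $s$-permutation: word with each $i\in[n]$ occurring $s_i$ times and avoiding $121$; $w_{[i]}$ is the prefix of length $i$. Graph $G_s$ ($s_{n+1}:=2$): vertices $v_{-1},\dots,v_n$; source-edges $e^i_1,\dots,e^i_{s_i-1}$ from $v_{-1}$ to $v_{n+1-i}$ ($i\in[1,n+1]$); bump $e^i_0$ and dip $e^i_{s_i}$ from $v_{n-i}$ to $v_{n+1-i}$ ($i\in[1,n]$). Routes are $R(k,t,\delta)=(e^k_t,e^{k-1}_{\delta_{k-1}s_{k-1}},\dots,e^1_{\delta_1s_1})$, $k\in[1,n+1]$, $t\in[1,s_k-1]$, $\delta\in\{0,1\}^{k-1}$. $\mathcal F_{G_s}\subset\mathbb R^E$: unit flow polytope (netflow $1$ at $v_{-1}$, $-1$ at $v_n$), vertices the indicator vectors $\chi_R$ of routes. Framing: incoming edges at $v_{n+1-i}$ ordered $e^i_0\prec\dots\prec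 e^i_{s_i}$; outgoing ordered $e^{i-1}_0\prec e^{i-1}_{s_{i-1}}$. Routes are coherent if at each maximal common subpath between inner vertices $v_i,v_j$ their initial parts up to $v_i$ and final parts from $v_j$ are ordered the same way (partial routes compared by the framing order at the vertex of last, resp. first, divergence); simplices spanned by sets of pairwise coherent routes form the DKK triangulation. $h$ (routes $\to\mathbb R$) is admissible if the DKK triangulation is exactly the projection of the lower faces of $\mathrm{conv}\{(\chi_R,h(R))\}$. For $k\in[2,n+1]$, $t\in[1,s_k-1]$, $x\in\mathbb R^n$: $F^k_t(x)=\min_{\delta\in\{0,1\}^{k-1}}(h(R(k,t,\delta))+\sum_{i<k}\delta_ix_i)$, with minimizer set $M^k_t(x)$. Cells $C(x)=\{y:M^k_t(x)\subseteq M^k_t(y)\ \forall k,t\}$ form a polyhedral complex; $\mathcal P_h$ is its subcomplex of bounded cells. For a prefix $u$: $t_a$ = number of $a$'s in $u$; $c$ = smallest $a$ with $0<t_a<s_a$ (else $c=n+1$, $t_{n+1}=1$); $\mathrm{route}(u)=(e^c_{t_c},\dots,e^1_{t_1})$; $\Delta_w=\{\mathrm{route}(w_{[i]}):0\le i\le|s|\}$. $v(w)$ denotes the point of $\mathcal P_h$ associated to $w$: the point $x$ with $\delta\in M^k_t(x)$ for every route $R(k,t,\delta)\in\Delta_w$ with $k\ge2$. *)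

theory Defs
  imports "HOL-Analysis.Analysis" "HOL-Analysis.Finite_Function_Topology"
begin

section \<open>Compositions and Stirling permutations\<close>

definition composition :: "nat list \<Rightarrow> bool" where
  "composition s \<longleftrightarrow> (\<forall>p\<in>set s. 0 < p)"

text \<open>Parts are numbered from 1, and the convention \<open>s\<^sub>n\<^sub>+\<^sub>1 = 2\<close> is built in.\<close>

definition comp_part :: "nat list \<Rightarrow> nat \<Rightarrow> nat" where
  "comp_part s i = (s @ [2]) ! (i - 1)"

definition stirling_perms :: "nat list \<Rightarrow> nat list set" where
  "stirling_perms s =
    {w. set w \<subseteq> {1..length s} \<and> (\<forall>i\<in>{1..length s}. count_list w i = comp_part s i) \<and>
        \<not> (\<exists>i j k. i < j \<and> j < k \<and> k < length w \<and> w ! i = w ! k \<and> w ! i < w ! j)}"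

section \<open>The graph \<open>G\<^sub>s\<close>, its framing and its routes\<close>

text \<open>The pair \<open>(i, t)\<close> is the edge \<open>e\<^sup>i\<^sub>t\<close>, and the integer \<open>j\<close> is the vertex \<open>v\<^sub>j\<close>.\<close>

type_synonym edge = "nat \<times> nat"

definition edge_head :: "nat list \<Rightarrow> edge \<Rightarrow> int" where
  "edge_head s e = int (length s) + 1 - int (fst e)"

definition edge_tail :: "nat list \<Rightarrow> edge \<Rightarrow> int" where
  "edge_tail s e =
    (if 1 \<le> snd e \<and> snd e < comp_part s (fst e) then - 1 else int (length s) - int (fst e))"

definition inner_vertex :: "nat list \<Rightarrow> int \<Rightarrow> bool" where
  "inner_vertex s v \<longleftrightarrow> 0 \<le> v \<and> v < int (length s)"

definition in_less :: "nat list \<Rightarrow> edge \<Rightarrow> edge \<Rightarrow> bool" where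
  "in_less s e f \<longleftrightarrow> edge_head s e = edge_head s f \<and> snd e < snd f"

definition out_less :: "nat list \<Rightarrow> edge \<Rightarrow> edge \<Rightarrow> bool" where
  "out_less s e f \<longleftrightarrow> edge_tail s e = edge_tail s f \<and> snd e < snd f"

definition cube :: "nat \<Rightarrow> (nat \<Rightarrow> nat) set" where
  "cube k = {1..<k} \<rightarrow>\<^sub>E {0, 1}"

definition route :: "nat list \<Rightarrow> nat \<Rightarrow> nat \<Rightarrow> (nat \<Rightarrow> nat) \<Rightarrow> edge list" where
  "route s k t \<delta> = (k, t) # map (\<lambda>i. (i, \<delta> i * comp_part s i)) (rev [1..<k])"

definition routes :: "nat list \<Rightarrow> edge list set" where
  "routes s = {route s k t \<delta> | k t \<delta>.
     k \<in> {1..length s + 1} \<and> t \<in> {1..comp_part s k - 1} \<and> \<delta> \<in> cube k}"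

section \<open>Coherence and the DKK triangulation\<close>

text \<open>
  Initial parts ending at a common vertex are compared at their last divergence, final parts
  starting at a common vertex at their first divergence.
\<close>

definition initial_less :: "nat list \<Rightarrow> edge list \<Rightarrow> edge list \<Rightarrow> bool" where
  "initial_less s P Q \<longleftrightarrow>
    (\<exists>A B C e f. P = A @ e # C \<and> Q = B @ f # C \<and> in_less s e f)"

definition final_less :: "nat list \<Rightarrow> edge list \<Rightarrow> edge list \<Rightarrow> bool" where
  "final_less s P Q \<longleftrightarrow>
    (\<exists>A B C e f. P = C @ e # A \<and> Q = C @ f # B \<and> out_less s e f)"

text \<open>
  The common subpath \<open>C\<close> is a single vertex if \<open>C = []\<close>. Its ends are inner vertices
  because the four outer parts are nonempty; it is maximal if it cannot be prolonged to a
  further inner vertex.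
\<close>

definition max_common_subpath ::
  "nat list \<Rightarrow> edge list \<Rightarrow> edge list \<Rightarrow> edge list \<Rightarrow>
    edge list \<times> edge list \<Rightarrow> edge list \<times> edge list \<Rightarrow> bool" where
  "max_common_subpath s P Q C = (\<lambda>(P\<^sub>1, P\<^sub>2) (Q\<^sub>1, Q\<^sub>2).
    P = P\<^sub>1 @ C @ P\<^sub>2 \<and> Q = Q\<^sub>1 @ C @ Q\<^sub>2 \<and>
    P\<^sub>1 \<noteq> [] \<and> Q\<^sub>1 \<noteq> [] \<and> P\<^sub>2 \<noteq> [] \<and> Q\<^sub>2 \<noteq> [] \<and>
    edge_head s (last P\<^sub>1) = edge_head s (last Q\<^sub>1) \<and>
    \<not> (last P\<^sub>1 = last Q\<^sub>1 \<and> inner_vertex s (edge_tail s (last P\<^sub>1))) \<and>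
    \<not> (hd P\<^sub>2 = hd Q\<^sub>2 \<and> inner_vertex s (edge_head s (hd P\<^sub>2))))"

text \<open>
  Parts that do not diverge are equal and impose no condition: only two strict comparisons in
  opposite directions are a conflict.
\<close>

definition coherent :: "nat list \<Rightarrow> edge list \<Rightarrow> edge list \<Rightarrow> bool" where
  "coherent s P Q \<longleftrightarrow>
    (\<forall>C P\<^sub>1 P\<^sub>2 Q\<^sub>1 Q\<^sub>2. max_common_subpath s P Q C (P\<^sub>1, P\<^sub>2) (Q\<^sub>1, Q\<^sub>2) \<longrightarrow>
      \<not> (initial_less s P\<^sub>1 Q\<^sub>1 \<and> final_less s Q\<^sub>2 P\<^sub>2) \<and>
      \<not> (initial_less s Q\<^sub>1 P\<^sub>1 \<and> final_less s P\<^sub>2 Q\<^sub>2))"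

text \<open>
  Finitely supported functions on edges carry the vector space structure of \<open>\<real>\<^sup>E\<close>; all
  indicator vectors of routes are supported on the edges of \<open>G\<^sub>s\<close>.
\<close>

definition indicator_vec :: "edge list \<Rightarrow> (edge \<Rightarrow>\<^sub>0 real)" where
  "indicator_vec R = (\<Sum>e\<in>set R. Poly_Mapping.single e 1)"

definition dkk_triangulation :: "nat list \<Rightarrow> (edge \<Rightarrow>\<^sub>0 real) set set" where
  "dkk_triangulation s = {convex hull (indicator_vec ` S) | S.
     S \<subseteq> routes s \<and> S \<noteq> {} \<and> pairwise (coherent s) S}"

text \<open>
  A nonempty face is lower if it has an inner normal vector with positive last coordinate,
  which is scaled to 1 here. The empty face is left out, as is the empty simplex above.
\<close>

definition lower_face :: "('a::real_vector \<times> real) set \<Rightarrow> ('a \<times> real) set \<Rightarrow> bool" where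
  "lower_face P F \<longleftrightarrow> F \<noteq> {} \<and>
    (\<exists>\<phi>. linear \<phi> \<and> F = {p\<in>P. \<forall>q\<in>P. \<phi> (fst p) + snd p \<le> \<phi> (fst q) + snd q})"

definition admissible :: "nat list \<Rightarrow> (edge list \<Rightarrow> real) \<Rightarrow> bool" where
  "admissible s h \<longleftrightarrow>
    {fst ` F | F. lower_face (convex hull ((\<lambda>R. (indicator_vec R, h R)) ` routes s)) F}
      = dkk_triangulation s"

section \<open>The complex of bounded cells\<close>

definition Rn :: "nat \<Rightarrow> (nat \<Rightarrow>\<^sub>0 real) set" where
  "Rn n = {x. Poly_Mapping.keys x \<subseteq> {1..n}}"

definition trop_term ::
  "nat list \<Rightarrow> (edge list \<Rightarrow> real) \<Rightarrow> nat \<Rightarrow> nat \<Rightarrow> (nat \<Rightarrow>\<^sub>0 real) \<Rightarrow> (nat \<Rightarrow> nat) \<Rightarrow> real" where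
  "trop_term s h k t x \<delta> =
    h (route s k t \<delta>) + (\<Sum>i\<in>{1..<k}. real (\<delta> i) * Poly_Mapping.lookup x i)"

definition trop_min ::
  "nat list \<Rightarrow> (edge list \<Rightarrow> real) \<Rightarrow> nat \<Rightarrow> nat \<Rightarrow> (nat \<Rightarrow>\<^sub>0 real) \<Rightarrow> real" where
  "trop_min s h k t x = Min (trop_term s h k t x ` cube k)"

definition minimizers ::
  "nat list \<Rightarrow> (edge list \<Rightarrow> real) \<Rightarrow> nat \<Rightarrow> nat \<Rightarrow> (nat \<Rightarrow>\<^sub>0 real) \<Rightarrow> (nat \<Rightarrow> nat) set" where
  "minimizers s h k t x = {\<delta> \<in> cube k. trop_term s h k t x \<delta> = trop_min s h k t x}"

definition cell ::
  "nat list \<Rightarrow> (edge list \<Rightarrow> real) \<Rightarrow> (nat \<Rightarrow>\<^sub>0 real) \<Rightarrow> (nat \<Rightarrow>\<^sub>0 real) set" where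
  "cell s h x = {y \<in> Rn (length s).
     \<forall>k\<in>{2..length s + 1}. \<forall>t\<in>{1..comp_part s k - 1}. minimizers s h k t x \<subseteq> minimizers s h k t y}"

definition bounded_complex ::
  "nat list \<Rightarrow> (edge list \<Rightarrow> real) \<Rightarrow> (nat \<Rightarrow>\<^sub>0 real) set set" where
  "bounded_complex s h = {cell s h x | x. x \<in> Rn (length s) \<and> bounded (cell s h x)}"

text \<open>The vertices of a polyhedral complex, given as its set of cells, are its 0-dimensional cells.\<close>

definition complex_vertices :: "'a set set \<Rightarrow> 'a set" where
  "complex_vertices K = {p. {p} \<in> K}"

section \<open>The point associated to a Stirling permutation\<close>

definition prefix_source :: "nat list \<Rightarrow> nat list \<Rightarrow> nat" where
  "prefix_source s u =
    Min ({a \<in> {1..length s}. 0 < count_list u a \<and> count_list u a < comp_part s a} \<union> {length s + 1})"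

definition prefix_route :: "nat list \<Rightarrow> nat list \<Rightarrow> edge list" where
  "prefix_route s u =
    map (\<lambda>a. (a, if a = length s + 1 then 1 else count_list u a)) (rev [1..<Suc (prefix_source s u)])"

definition Delta :: "nat list \<Rightarrow> nat list \<Rightarrow> edge list set" where
  "Delta s w = (\<lambda>i. prefix_route s (take i w)) ` {0..sum_list s}"

definition associated_point ::
  "nat list \<Rightarrow> (edge list \<Rightarrow> real) \<Rightarrow> nat list \<Rightarrow> (nat \<Rightarrow>\<^sub>0 real) \<Rightarrow> bool" where
  "associated_point s h w x \<longleftrightarrow> x \<in> Rn (length s) \<and>
    (\<forall>k\<in>{2..length s + 1}. \<forall>t\<in>{1..comp_part s k - 1}. \<forall>\<delta>\<in>cube k.
      route s k t \<delta> \<in> Delta s w \<longrightarrow> \<delta> \<in> minimizers s h k t x)"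

definition vertex_point ::
  "nat list \<Rightarrow> (edge list \<Rightarrow> real) \<Rightarrow> nat list \<Rightarrow> (nat \<Rightarrow>\<^sub>0 real)" where
  "vertex_point s h w = (THE x. associated_point s h w x)"

text \<open>
  The length of the prefix of \<open>w\<close> before the \<open>t\<close>-th occurrence of \<open>a\<close> is the 0-based
  position of that occurrence; \<open>t\<close> counts from 1.
\<close>

definition occ_prefix :: "nat list \<Rightarrow> nat \<Rightarrow> nat \<Rightarrow> nat" where
  "occ_prefix w a t = filter (\<lambda>i. w ! i = a) [0..<length w] ! (t - 1)"

end

theory Submission
  imports Defs
begin

text \<open>
  Two routes are coherent iff one of them is pointwise below the other on the levels that both
  visit. By the Cayley trick, a point \<open>x\<close> amounts to edge weights with
  \<open>x\<^sub>i = \<omega>(e\<^sup>i\<^sub>s\<^sub>i) - \<omega>(e\<^sup>i\<^sub>0)\<close>, and minimizers at \<open>x\<close> are the routes minimizing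
  weight plus height. Admissibility says that the sets of such routes are coherent, and that every
  coherent set consists of minimizers for suitable weights. The latter, applied to \<open>\<Delta>\<^sub>w\<close>, gives
  \<open>v(w)\<close>; along the prefixes of \<open>w\<close> the heights are minus the weights, which telescope to the
  formula and to uniqueness. If \<open>w \<noteq> w'\<close>, two routes at the first difference cross, so \<open>v\<close> is
  injective. Conversely, a coherent set of routes is contained in some \<open>\<Delta>\<^sub>w\<close>, built greedily
  letter by letter so that every route of the set stays above or below the current letter counts;
  hence the cell of any point contains some \<open>v(w)\<close>, and a cell consisting of one point is \<open>{v(w)}\<close>.
\<close>

section \<open>Routes as lists of values\<close>

text \<open>One function records source index, bumps and dips alike, so that comparing two routes at
  a level becomes comparing two numbers. Only the values on \<open>{1..k}\<close> matter.\<close>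

definition value_route :: "(nat \<Rightarrow> nat) \<Rightarrow> nat \<Rightarrow> edge list" where
  "value_route f k = map (\<lambda>i. (i, f i)) (rev [1..<Suc k])"

definition route_values :: "nat list \<Rightarrow> (nat \<Rightarrow> nat) \<Rightarrow> nat \<Rightarrow> bool" where
  "route_values s f k \<longleftrightarrow> k \<in> {1..length s + 1} \<and> 0 < f k \<and> f k < comp_part s k \<and>
    (\<forall>i\<in>{1..<k}. f i = 0 \<or> f i = comp_part s i)"

lemma set_value_route: "set (value_route f k) = (\<lambda>i. (i, f i)) ` {1..k}"
  by (auto simp: value_route_def)

lemma mem_value_route: "(i, v) \<in> set (value_route f k) \<longleftrightarrow> 1 \<le> i \<and> i \<le> k \<and> v = f i"
  by (auto simp: set_value_route)

lemma value_route_cong: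
  "(\<And>i. 1 \<le> i \<Longrightarrow> i \<le> k \<Longrightarrow> f i = g i) \<Longrightarrow> value_route f k = value_route g k"
  by (auto simp: value_route_def)

text \<open>Cut into the three pieces that \<open>max_common_subpath\<close> asks for: the route
  down to level \<open>b\<close>, the levels strictly between \<open>c\<close> and \<open>b\<close>,
  and the rest from level \<open>c\<close> on.\<close>

lemma value_route_split:
  assumes "1 \<le> c" "c < b" "b \<le> k"
  shows "value_route f k =
    (map (\<lambda>i. (i, f i)) (rev [Suc b..<Suc k]) @ [(b, f b)]) @
      map (\<lambda>i. (i, f i)) (rev [Suc c..<b]) @ (c, f c) # map (\<lambda>i. (i, f i)) (rev [1..<c])"
proof -
  have "[1..<Suc k] = [1..<Suc c] @ [Suc c..<b] @ [b..<Suc k]"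
    using assms upt_add_eq_append[of 1 "Suc c" "Suc k - Suc c"]
      upt_add_eq_append[of "Suc c" b "Suc k - b"] by auto
  moreover have "[b..<Suc k] = b # [Suc b..<Suc k]" using assms by (simp add: upt_rec)
  ultimately show ?thesis using assms by (simp add: value_route_def)
qed

lemma value_route_Cons:
  "1 \<le> k \<Longrightarrow> value_route f k = (k, f k) # map (\<lambda>i. (i, f i)) (rev [1..<k])"
  by (simp add: value_route_def)

lemma route_eq_value_route:
  "1 \<le> k \<Longrightarrow> route s k t \<delta> = value_route (\<lambda>i. if i = k then t else \<delta> i * comp_part s i) k"
  by (auto simp: value_route_Cons route_def)

lemma route_values_route:
  fixes \<delta> :: "nat \<Rightarrow> nat"
  assumes "k \<in> {1..length s + 1}" "t \<in> {1..comp_part s k - 1}" "\<delta> \<in> cube k"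
  shows "route_values s (\<lambda>i. if i = k then t else \<delta> i * comp_part s i) k"
  using assms by (auto simp: route_values_def cube_def PiE_iff)

lemma routes_eq: "routes s = {value_route f k | f k. route_values s f k}"
proof (intro set_eqI iffI)
  fix R assume "R \<in> routes s"
  then obtain k t \<delta> where "R = route s k t \<delta>" "k \<in> {1..length s + 1}"
    "t \<in> {1..comp_part s k - 1}" "\<delta> \<in> cube k"
    by (auto simp: routes_def)
  then show "R \<in> {value_route f k | f k. route_values s f k}"
    using route_eq_value_route[of k] route_values_route[of k s t \<delta>] by auto
next
  fix R assume "R \<in> {value_route f k | f k. route_values s f k}"
  then obtain f k where R: "R = value_route f k" and f: "route_values s f k" by auto
  define \<delta> where "\<delta> = restrict (\<lambda>i. if f i = 0 then 0 else 1 :: nat) {1..<k}"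
  have "\<delta> \<in> cube k" by (auto simp: \<delta>_def cube_def)
  moreover have "R = route s k (f k) \<delta>"
    using f unfolding R
    by (subst route_eq_value_route)
      (force simp: \<delta>_def route_values_def intro!: value_route_cong)+
  ultimately show "R \<in> routes s" using f unfolding routes_def route_values_def by fastforce
qed

lemma routesE:
  assumes "R \<in> routes s"
  obtains f k where "R = value_route f k" "route_values s f k"
  using assms by (auto simp: routes_eq)

lemma finite_cube: "finite (cube k)"
  by (auto simp: cube_def intro: finite_PiE)

lemma finite_routes: "finite (routes s)"
proof -
  have "finite (\<Union>k\<in>{1..length s + 1}. \<Union>t\<in>{1..comp_part s k - 1}. route s k t ` cube k)"
    using finite_cube by blast
  moreover have "routes s = (\<Union>k\<in>{1..length s + 1}. \<Union>t\<in>{1..comp_part s k - 1}. route s k t ` cube k)"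
    unfolding routes_def by blast
  ultimately show ?thesis by simp
qed

text \<open>The source-edge of \<open>R\<close> has a value strictly between 0 and the part at its
  level, while a route passing that level below its own source has value 0 or the full part there.
  So \<open>Q\<close> starts at the same level as \<open>R\<close>.\<close>

lemma routes_subset_eq:
  assumes "R \<in> routes s" "Q \<in> routes s" "set R \<subseteq> set Q"
  shows "R = Q"
proof -
  obtain f k where R: "R = value_route f k" "route_values s f k" using assms(1) by (rule routesE)
  obtain g l where Q: "Q = value_route g l" "route_values s g l" using assms(2) by (rule routesE)
  have eq: "f i = g i \<and> i \<le> l" if "1 \<le> i" "i \<le> k" for i
    using subsetD[OF assms(3), of "(i, f i)"] that unfolding R Q by (simp add: mem_value_route)
  have "k = l"
  proof (rule ccontr)
    assume "k \<noteq> l"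
    then have "k < l" "f k = g k" using eq[of k] R by (auto simp: route_values_def)
    then show False using R(2) Q(2) by (force simp: route_values_def)
  qed
  then show ?thesis unfolding R Q using eq by (auto intro: value_route_cong)
qed

section \<open>Coherence is comparability\<close>

text \<open>Levels visited by only one of the routes are left free, so this relation is not
  transitive.\<close>

definition route_le :: "edge list \<Rightarrow> edge list \<Rightarrow> bool" where
  "route_le P Q \<longleftrightarrow> (\<forall>i v v'. (i, v) \<in> set P \<longrightarrow> (i, v') \<in> set Q \<longrightarrow> v \<le> v')"

text \<open>Only the first edge of a route is a source-edge. After it there are bumps and dips,
  whose tail determines their level.\<close>

lemma edge_tail_tl:
  assumes "R \<in> routes s" "e \<in> set (tl R)"
  shows "edge_tail s e = int (length s) - int (fst e)"
proof -
  obtain f k where R: "R = value_route f k" "route_values s f k" using assms(1) by (rule routesE)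
  then show ?thesis using assms(2)
    by (force simp: value_route_Cons route_values_def edge_tail_def)
qed

text \<open>At a last divergence the two edges share a head, hence a level. At a first divergence
  they share a tail, which also fixes the level, because \<open>P2\<close> and \<open>Q2\<close> lie
  below the source-edges. Then \<open>route_le\<close> excludes one direction of each comparison,
  and each conflict contains an excluded one.\<close>

lemma route_le_no_conflict:
  assumes "P \<in> routes s" "Q \<in> routes s" "route_le P Q"
    and mcs: "max_common_subpath s P Q C (P1, P2) (Q1, Q2)"
  shows "\<not> (initial_less s P1 Q1 \<and> final_less s Q2 P2)"
    and "\<not> (initial_less s Q1 P1 \<and> final_less s P2 Q2)"
proof -
  have PQ: "P = P1 @ C @ P2" "Q = Q1 @ C @ Q2" "P1 \<noteq> []" "Q1 \<noteq> []"
    using mcs by (auto simp: max_common_subpath_def)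
  have tl: "set P2 \<subseteq> set (tl P)" "set Q2 \<subseteq> set (tl Q)" using PQ by auto
  have "False" if fl: "final_less s Q2 P2"
  proof -
    obtain A B D e f where ef: "Q2 = D @ e # A" "P2 = D @ f # B" "out_less s e f"
      using fl by (auto simp: final_less_def)
    then have "fst e = fst f"
      using edge_tail_tl[OF assms(1), of f] edge_tail_tl[OF assms(2), of e] tl
      by (auto simp: out_less_def)
    moreover have "snd f \<le> snd e" if "fst e = fst f"
      using assms(3) ef(1,2) PQ that unfolding route_le_def
      by (metis Un_iff list.set_intros(1) prod.collapse set_append)
    ultimately show False using ef(3) by (auto simp: out_less_def)
  qed
  then show "\<not> (initial_less s P1 Q1 \<and> final_less s Q2 P2)" by blast
  have "False" if il: "initial_less s Q1 P1"
  proof -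
    obtain A B D e f where ef: "Q1 = A @ e # D" "P1 = B @ f # D" "in_less s e f"
      using il by (auto simp: initial_less_def)
    then have "fst e = fst f" by (auto simp: in_less_def edge_head_def)
    moreover have "snd f \<le> snd e" if "fst e = fst f"
      using assms(3) ef(1,2) PQ that unfolding route_le_def
      by (metis Un_iff list.set_intros(1) prod.collapse set_append)
    ultimately show False using ef(3) by (auto simp: in_less_def)
  qed
  then show "\<not> (initial_less s Q1 P1 \<and> final_less s P2 Q2)" by blast
qed

lemma max_common_subpath_swap:
  "max_common_subpath s P Q C (P1, P2) (Q1, Q2) = max_common_subpath s Q P C (Q1, Q2) (P1, P2)"
  by (auto simp: max_common_subpath_def)

lemma coherent_swap: "coherent s P Q = coherent s Q P"
  unfolding coherent_def using max_common_subpath_swap by blast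

lemma route_le_imp_coherent:
  "P \<in> routes s \<Longrightarrow> Q \<in> routes s \<Longrightarrow> route_le P Q \<Longrightarrow> coherent s P Q"
  unfolding coherent_def using route_le_no_conflict by blast

text \<open>Take \<open>b\<close> as the lowest level above \<open>c0\<close> where \<open>f\<close>
  is smaller, and \<open>c\<close> as the highest level below \<open>b\<close> where
  \<open>g\<close> is smaller. In between the routes agree, so this stretch (a single vertex if
  \<open>c\<close> and \<open>b\<close> are adjacent) is a maximal common subpath, ordered one way
  before it and the other way after it.\<close>

lemma crossing_not_coherent:
  assumes f: "route_values s f k" and g: "route_values s g l"
    and "1 \<le> c0" "c0 < b0" "b0 \<le> k" "b0 \<le> l" "g c0 < f c0" "f b0 < g b0"
  shows "\<not> coherent s (value_route f k) (value_route g l)"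
proof -
  define b where "b = (LEAST i. c0 < i \<and> f i < g i)"
  have b: "c0 < b" "f b < g b" "b \<le> b0"
    unfolding b_def using LeastI[of "\<lambda>i. c0 < i \<and> f i < g i" b0] assms
    by (auto intro: Least_le)
  have bmin: "\<not> f i < g i" if "c0 < i" "i < b" for i
    using not_less_Least[of i "\<lambda>i. c0 < i \<and> f i < g i"] that unfolding b_def by blast
  define c where "c = (GREATEST i. i < b \<and> g i < f i)"
  have c: "c < b" "g c < f c" "c0 \<le> c"
    unfolding c_def
    using GreatestI_nat[of "\<lambda>i. i < b \<and> g i < f i" c0 b]
      Greatest_le_nat[of "\<lambda>i. i < b \<and> g i < f i" c0 b] assms b
    by auto
  have cmax: "\<not> g i < f i" if "c < i" "i < b" for i
    using Greatest_le_nat[of "\<lambda>i. i < b \<and> g i < f i" i b] that unfolding c_def by fastforce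
  have mid: "f i = g i" if "c < i" "i < b" for i
    using bmin[of i] cmax[of i] c that by fastforce
  define C where "C = map (\<lambda>i. (i, f i)) (rev [Suc c..<b])"
  have C': "C = map (\<lambda>i. (i, g i)) (rev [Suc c..<b])" unfolding C_def using mid by auto
  define P1 where "P1 = map (\<lambda>i. (i, f i)) (rev [Suc b..<Suc k]) @ [(b, f b)]"
  define Q1 where "Q1 = map (\<lambda>i. (i, g i)) (rev [Suc b..<Suc l]) @ [(b, g b)]"
  define P2 where "P2 = (c, f c) # map (\<lambda>i. (i, f i)) (rev [1..<c])"
  define Q2 where "Q2 = (c, g c) # map (\<lambda>i. (i, g i)) (rev [1..<c])"
  have "value_route f k = P1 @ C @ P2"
    unfolding P1_def P2_def C_def by (rule value_route_split) (use assms b c in auto)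
  moreover have "value_route g l = Q1 @ C @ Q2"
    unfolding Q1_def Q2_def C' by (rule value_route_split) (use assms b c in auto)
  ultimately have mcs: "max_common_subpath s (value_route f k) (value_route g l) C (P1, P2) (Q1, Q2)"
    using b c by (simp add: max_common_subpath_def P1_def Q1_def P2_def Q2_def edge_head_def)
  have il: "initial_less s P1 Q1"
    unfolding initial_less_def P1_def Q1_def using b
    by (intro exI[of _ "map (\<lambda>i. (i, f i)) (rev [Suc b..<Suc k])"]
        exI[of _ "map (\<lambda>i. (i, g i)) (rev [Suc b..<Suc l])"] exI[of _ "[]"])
      (auto simp: in_less_def edge_head_def)
  have fl: "final_less s Q2 P2"
  proof -
    \<comment> \<open>Strictly below both sources the edges at level \<open>c\<close> are a bump and
      a dip, so they leave the same vertex and are comparable by the framing.\<close>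
    have "c \<in> {1..<k}" "c \<in> {1..<l}" using assms b c by auto
    then have "f c = 0 \<or> f c = comp_part s c" "g c = 0 \<or> g c = comp_part s c"
      using f g unfolding route_values_def by blast+
    then have "edge_tail s (c, f c) = int (length s) - int c"
      "edge_tail s (c, g c) = int (length s) - int c"
      unfolding edge_tail_def fst_conv snd_conv by (metis less_irrefl not_one_le_zero)+
    then have "out_less s (c, g c) (c, f c)"
      using c by (simp add: out_less_def)
    then show ?thesis unfolding final_less_def P2_def Q2_def by (metis append_Nil)
  qed
  show ?thesis
  proof
    assume "coherent s (value_route f k) (value_route g l)"
    from this[unfolded coherent_def, rule_format, OF mcs] il fl show False by blast
  qed
qed

lemma coherent_crossing:
  assumes "P \<in> routes s" "Q \<in> routes s" "coherent s P Q"
    and "(i, v) \<in> set P" "(i, v') \<in> set Q" "v < v'" "(j, u) \<in> set P" "(j, u') \<in> set Q" "u' < u"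
  shows False
proof -
  obtain f k where P: "P = value_route f k" "route_values s f k" using assms(1) by (rule routesE)
  obtain g l where Q: "Q = value_route g l" "route_values s g l" using assms(2) by (rule routesE)
  have i: "1 \<le> i" "i \<le> k" "i \<le> l" "f i < g i" using assms P Q by (auto simp: mem_value_route)
  have j: "1 \<le> j" "j \<le> k" "j \<le> l" "g j < f j" using assms P Q by (auto simp: mem_value_route)
  consider "i < j" | "j < i" using i j by (cases i j rule: linorder_cases) auto
  then show False
  proof cases
    case 1
    then show False using crossing_not_coherent[OF Q(2) P(2), of i j] i j assms(3) coherent_swap
      unfolding P Q by blast
  next
    case 2
    then show False using crossing_not_coherent[OF P(2) Q(2), of j i] i j assms(3)
      unfolding P Q by blast
  qed
qed

section \<open>Admissible heights and edge weights\<close>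

text \<open>The value at the lifted vertex of \<open>R\<close> of the functional with coefficients
  \<omega> on the edges and 1 on the height. The routes minimizing it lie on a common lower
  face.\<close>

definition weighted :: "(edge \<Rightarrow> real) \<Rightarrow> (edge list \<Rightarrow> real) \<Rightarrow> edge list \<Rightarrow> real" where
  "weighted \<omega> h R = (\<Sum>e\<in>set R. \<omega> e) + h R"

section \<open>Linear functionals on indicator vectors\<close>

lemma lookup_scaleR: "Poly_Mapping.lookup (r *\<^sub>R x) e = r *\<^sub>R Poly_Mapping.lookup x e"
  by (simp add: scaleR_poly_mapping_def Poly_Mapping.map.rep_eq when_def)

lemma lookup_indicator_vec:
  "Poly_Mapping.lookup (indicator_vec R) e = (if e \<in> set R then 1 else 0)"
  by (simp add: indicator_vec_def lookup_sum lookup_single when_def)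

lemma linear_weight:
  fixes \<omega> :: "edge \<Rightarrow> real"
  shows "linear (\<lambda>x. \<Sum>e\<in>E. \<omega> e * Poly_Mapping.lookup x e)"
  by (rule linearI)
    (simp_all add: lookup_add lookup_scaleR distrib_left sum.distrib sum_distrib_left mult.left_commute)

lemma weight_indicator_vec:
  "finite E \<Longrightarrow> (\<Sum>e\<in>E. \<omega> e * Poly_Mapping.lookup (indicator_vec R) e) = (\<Sum>e\<in>E \<inter> set R. \<omega> e)"
  by (simp add: lookup_indicator_vec sum.inter_restrict if_distrib cong: if_cong)

lemma linear_indicator_vec:
  fixes \<phi> :: "(edge \<Rightarrow>\<^sub>0 real) \<Rightarrow> real"
  shows "linear \<phi> \<Longrightarrow> \<phi> (indicator_vec R) = (\<Sum>e\<in>set R. \<phi> (Poly_Mapping.single e 1))"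
  by (simp add: indicator_vec_def linear_sum)

text \<open>The number of edges shared with \<open>R\<close> is a linear functional that separates \<open>R\<close>
  from the other routes, because no route contains another one.\<close>

definition overlap :: "edge list \<Rightarrow> (edge \<Rightarrow>\<^sub>0 real) \<Rightarrow> real" where
  "overlap R x = (\<Sum>e\<in>set R. 1 * Poly_Mapping.lookup x e)"

lemma linear_overlap: "linear (overlap R)"
  unfolding overlap_def by (rule linear_weight)

lemma overlap_indicator_vec: "overlap R (indicator_vec Q) = real (card (set R \<inter> set Q))"
  unfolding overlap_def by (subst weight_indicator_vec) auto

lemma overlap_other:
  assumes "R \<in> routes s" "Q \<in> routes s" "R \<noteq> Q"
  shows "overlap R (indicator_vec Q) \<le> overlap R (indicator_vec R) - 1"
proof -
  have "set R \<inter> set Q \<subset> set R" using routes_subset_eq[OF assms(1,2)] assms(3) by blast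
  then have "card (set R \<inter> set Q) < card (set R)" by (intro psubset_card_mono) auto
  then show ?thesis by (simp add: overlap_indicator_vec)
qed

text \<open>If \<open>R\<close> were not in \<open>S\<close>, the half-space where
  \<open>overlap R\<close> is at most its value at \<open>R\<close> minus 1 would contain the whole
  hull.\<close>

lemma indicator_vec_in_hull:
  assumes "R \<in> routes s" "S \<subseteq> routes s" "indicator_vec R \<in> convex hull (indicator_vec ` S)"
  shows "R \<in> S"
proof (rule ccontr)
  assume "R \<notin> S"
  let ?H = "overlap R -` {..overlap R (indicator_vec R) - 1}"
  have "indicator_vec ` S \<subseteq> ?H"
    using \<open>R \<notin> S\<close> assms overlap_other[of R s] by fastforce
  moreover have "convex ?H"
    by (intro convex_linear_vimage linear_overlap) (simp add: convex_real_interval)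
  ultimately have "convex hull (indicator_vec ` S) \<subseteq> ?H" by (rule hull_minimal)
  then show False using assms(3) by auto
qed

text \<open>Since \<open>M\<close> bounds all height differences from \<open>h R\<close>, the loss
  of at least \<open>M\<close> in \<open>M * overlap R\<close> at another route outweighs any change
  of height, upwards or downwards. The two resulting half-spaces contain the lifted polytope and
  leave only the height \<open>h R\<close> over the vector of \<open>R\<close>.\<close>

lemma height_over_indicator_vec:
  fixes h :: "edge list \<Rightarrow> real"
  assumes R: "R \<in> routes s"
    and z: "(indicator_vec R, z) \<in> convex hull ((\<lambda>Q. (indicator_vec Q, h Q)) ` routes s)"
  shows "z = h R"
proof -
  define M where "M = (\<Sum>Q\<in>routes s. \<bar>h Q - h R\<bar>)"
  have M: "\<bar>h Q - h R\<bar> \<le> M" if "Q \<in> routes s" for Q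
    unfolding M_def using that finite_routes[of s]
    by (intro member_le_sum[of Q "routes s" "\<lambda>Q. \<bar>h Q - h R\<bar>"]) auto
  then have M0: "0 \<le> M" using R by (metis abs_ge_zero order_trans)
  let ?c = "overlap R (indicator_vec R)"
  let ?f = "\<lambda>p. M * overlap R (fst p) + snd p" and ?g = "\<lambda>p. M * overlap R (fst p) - snd p"
  have lin: "linear ?f" "linear ?g"
    by (rule linearI;
        simp add: linear_add[OF linear_overlap] linear_scale[OF linear_overlap] algebra_simps)+
  let ?H = "?f -` {..M * ?c + h R} \<inter> ?g -` {..M * ?c - h R}"
  have "(indicator_vec Q, h Q) \<in> ?H" if Q: "Q \<in> routes s" for Q
  proof (cases "Q = R")
    case False
    then have "M * overlap R (indicator_vec Q) \<le> M * (?c - 1)"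
      using overlap_other[OF R Q] M0 by (intro mult_left_mono) auto
    then show ?thesis using M[OF Q] by (auto simp: algebra_simps)
  qed auto
  then have "(\<lambda>Q. (indicator_vec Q, h Q)) ` routes s \<subseteq> ?H" by blast
  moreover have "convex ?H"
    by (intro convex_Int convex_linear_vimage lin) (simp_all add: convex_real_interval)
  ultimately have "convex hull ((\<lambda>Q. (indicator_vec Q, h Q)) ` routes s) \<subseteq> ?H"
    by (rule hull_minimal)
  then have "(indicator_vec R, z) \<in> ?H" using z by blast
  then show ?thesis by simp
qed

text \<open>The simplex spanned by \<open>S\<close> is the projection of some lower face. The values
  of its normal functional on the unit vectors serve as weights.\<close>

lemma admissible_weights:
  assumes "admissible s h" "S \<subseteq> routes s" "S \<noteq> {}" "pairwise (coherent s) S"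
  obtains \<omega> where "\<And>R Q. R \<in> S \<Longrightarrow> Q \<in> routes s \<Longrightarrow> weighted \<omega> h R \<le> weighted \<omega> h Q"
proof -
  let ?P = "convex hull ((\<lambda>R. (indicator_vec R, h R)) ` routes s)"
  have "convex hull (indicator_vec ` S) \<in> dkk_triangulation s"
    unfolding dkk_triangulation_def using assms(2-4) by blast
  then obtain F where F: "lower_face ?P F" "convex hull (indicator_vec ` S) = fst ` F"
    using assms(1) unfolding admissible_def by blast
  then obtain \<phi> where \<phi>: "linear \<phi>"
    "F = {p\<in>?P. \<forall>q\<in>?P. \<phi> (fst p) + snd p \<le> \<phi> (fst q) + snd q}"
    unfolding lower_face_def by blast
  show ?thesis
  proof (rule that[of "\<lambda>e. \<phi> (Poly_Mapping.single e 1)"])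
    fix R Q assume R: "R \<in> S" and Q: "Q \<in> routes s"
    have "indicator_vec R \<in> fst ` F" unfolding F(2)[symmetric] using R by (simp add: hull_inc)
    \<comment> \<open>The projection hides the height of this point of the face. That it is the
      lifted vertex of \<open>R\<close> follows from
      \<open>height_over_indicator_vec\<close>.\<close>
    then obtain z where z: "(indicator_vec R, z) \<in> F" by force
    have "z = h R" using z \<phi>(2) R assms(2) by (intro height_over_indicator_vec[of R s]) auto
    moreover have "(indicator_vec Q, h Q) \<in> ?P" using Q by (intro hull_inc) auto
    ultimately have "\<phi> (indicator_vec R) + h R \<le> \<phi> (indicator_vec Q) + h Q"
      using z unfolding \<phi>(2) by force
    then show "weighted (\<lambda>e. \<phi> (Poly_Mapping.single e 1)) h R
        \<le> weighted (\<lambda>e. \<phi> (Poly_Mapping.single e 1)) h Q"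
      by (simp add: weighted_def linear_indicator_vec[OF \<phi>(1)])
  qed
qed

text \<open>The minimizing routes lie on one lower face, whose projection is a simplex spanned by a
  coherent set. By \<open>indicator_vec_in_hull\<close> a route whose vector lies in that simplex
  belongs to the spanning set.\<close>

lemma admissible_minimizers_coherent:
  assumes "admissible s h"
  shows "pairwise (coherent s) {R \<in> routes s. \<forall>Q\<in>routes s. weighted \<omega> h R \<le> weighted \<omega> h Q}"
    (is "pairwise _ ?S")
proof (cases "?S = {}")
  case False
  then obtain R0 where R0: "R0 \<in> ?S" by blast
  let ?P = "convex hull ((\<lambda>R. (indicator_vec R, h R)) ` routes s)"
  \<comment> \<open>The weights are arbitrary on all pairs of numbers. Restricting to the finitely
    many edges on routes makes the functional a finite sum.\<close>
  define E where "E = (\<Union>R\<in>routes s. set R)"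
  have E: "finite E" unfolding E_def using finite_routes by auto
  define \<phi> where "\<phi> = (\<lambda>x. \<Sum>e\<in>E. \<omega> e * Poly_Mapping.lookup x e)"
  have \<phi>: "linear \<phi>" unfolding \<phi>_def by (rule linear_weight)
  have val: "\<phi> (indicator_vec R) + h R = weighted \<omega> h R" if "R \<in> routes s" for R
  proof -
    have "E \<inter> set R = set R" using that by (auto simp: E_def)
    then show ?thesis using weight_indicator_vec[OF E, of \<omega> R] by (simp add: \<phi>_def weighted_def)
  qed
  let ?\<psi> = "\<lambda>p. \<phi> (fst p) + snd p"
  have "linear ?\<psi>"
    by (rule linearI; simp add: linear_add[OF \<phi>] linear_scale[OF \<phi>] algebra_simps)
  then have "convex (?\<psi> -` {weighted \<omega> h R0..})"
    by (intro convex_linear_vimage) (simp_all add: convex_real_interval)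
  moreover have "(\<lambda>R. (indicator_vec R, h R)) ` routes s \<subseteq> ?\<psi> -` {weighted \<omega> h R0..}"
    using R0 val by auto
  ultimately have ge: "?P \<subseteq> ?\<psi> -` {weighted \<omega> h R0..}" by (intro hull_minimal)
  define F where "F = {p\<in>?P. \<forall>q\<in>?P. \<phi> (fst p) + snd p \<le> \<phi> (fst q) + snd q}"
  have inF: "(indicator_vec R, h R) \<in> F" if R: "R \<in> ?S" for R
  proof -
    have "(indicator_vec R, h R) \<in> ?P" using R by (intro hull_inc) auto
    moreover have "?\<psi> (indicator_vec R, h R) \<le> weighted \<omega> h R0" using R R0 val by auto
    ultimately show ?thesis unfolding F_def using ge by fastforce
  qed
  have "lower_face ?P F" unfolding lower_face_def using inF[OF R0] \<phi> F_def by blast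
  then have "fst ` F \<in> dkk_triangulation s" using assms unfolding admissible_def by blast
  then obtain S' where S': "fst ` F = convex hull (indicator_vec ` S')" "S' \<subseteq> routes s"
    "pairwise (coherent s) S'"
    unfolding dkk_triangulation_def by blast
  have "?S \<subseteq> S'"
  proof
    fix R assume R: "R \<in> ?S"
    have "indicator_vec R \<in> convex hull (indicator_vec ` S')"
      unfolding S'(1)[symmetric] using imageI[OF inF[OF R], of fst] unfolding fst_conv .
    then show "R \<in> S'" 
      using R S'(2) by (intro indicator_vec_in_hull[of R s S']) simp_all
  qed
  then show ?thesis by (rule pairwise_subset[OF S'(3)])
next
  case True
  show ?thesis unfolding True by simp
qed

section \<open>Prefixes of Stirling permutations\<close>

text \<open>The letter \<open>n + 1\<close> counts as always partially placed, matching \<open>s\<^sub>n\<^sub>+\<^sub>1 = 2\<close>.\<close>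

definition letter_count :: "nat list \<Rightarrow> nat list \<Rightarrow> nat \<Rightarrow> nat" where
  "letter_count s u a = (if a = length s + 1 then 1 else count_list u a)"

definition partially_placed :: "nat list \<Rightarrow> nat list \<Rightarrow> nat \<Rightarrow> bool" where
  "partially_placed s u a \<longleftrightarrow> 0 < letter_count s u a \<and> letter_count s u a < comp_part s a"

lemma comp_part_last: "comp_part s (Suc (length s)) = 2"
  by (simp add: comp_part_def)

lemma comp_part_nth: "1 \<le> a \<Longrightarrow> a \<le> length s \<Longrightarrow> comp_part s a = s ! (a - 1)"
  by (simp add: comp_part_def nth_append) linarith

lemma comp_part_pos: "composition s \<Longrightarrow> 1 \<le> a \<Longrightarrow> a \<le> length s \<Longrightarrow> 0 < comp_part s a"
  by (simp add: composition_def comp_part_nth)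

lemma sum_comp_part: "(\<Sum>a\<in>{1..length s}. comp_part s a) = sum_list s"
proof -
  have "(\<Sum>a\<in>{1..length s}. comp_part s a) = (\<Sum>i\<in>{0..<length s}. comp_part s (Suc i))"
    by (rule sum.reindex_bij_witness[of _ Suc "\<lambda>a. a - 1"]) auto
  also have "\<dots> = (\<Sum>i\<in>{0..<length s}. s ! i)" by (rule sum.cong) (auto simp: comp_part_nth)
  finally show ?thesis by (simp add: sum_list_sum_nth)
qed

lemma prefix_source_eq:
  "prefix_source s u = Min {a \<in> {1..length s + 1}. partially_placed s u a}"
proof -
  have "{a \<in> {1..length s}. 0 < count_list u a \<and> count_list u a < comp_part s a} \<union> {length s + 1}
      = {a \<in> {1..length s + 1}. partially_placed s u a}"
    by (auto simp: partially_placed_def letter_count_def comp_part_last)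
  then show ?thesis by (simp add: prefix_source_def)
qed

lemma partially_placed_last: "partially_placed s u (Suc (length s))"
  by (simp add: partially_placed_def letter_count_def comp_part_last)

lemma prefix_source:
  shows "1 \<le> prefix_source s u" "prefix_source s u \<le> length s + 1"
    "partially_placed s u (prefix_source s u)"
proof -
  have "prefix_source s u \<in> {a \<in> {1..length s + 1}. partially_placed s u a}"
    unfolding prefix_source_eq using partially_placed_last[of s u] by (intro Min_in) auto
  then show "1 \<le> prefix_source s u" "prefix_source s u \<le> length s + 1"
    "partially_placed s u (prefix_source s u)" by auto
qed

lemma prefix_source_le:
  "1 \<le> a \<Longrightarrow> a \<le> length s + 1 \<Longrightarrow> partially_placed s u a \<Longrightarrow> prefix_source s u \<le> a"
  unfolding prefix_source_eq by (intro Min_le) auto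

lemma prefix_source_ge:
  "b \<le> length s + 1 \<Longrightarrow> (\<And>p. 1 \<le> p \<Longrightarrow> p < b \<Longrightarrow> \<not> partially_placed s u p) \<Longrightarrow> b \<le> prefix_source s u"
  using prefix_source[of s u] by (meson leI)

lemma prefix_source_eqI:
  assumes "1 \<le> k" "k \<le> length s + 1" "partially_placed s u k"
    and "\<And>p. 1 \<le> p \<Longrightarrow> p < k \<Longrightarrow> \<not> partially_placed s u p"
  shows "prefix_source s u = k"
  using prefix_source_le[of k s u] prefix_source_ge[of k s u] assms by (simp add: le_antisym)

lemma prefix_route_eq: "prefix_route s u = value_route (letter_count s u) (prefix_source s u)"
  by (simp add: prefix_route_def value_route_def letter_count_def)

lemma mem_prefix_route:
  "(i, v) \<in> set (prefix_route s u) \<longleftrightarrow> 1 \<le> i \<and> i \<le> prefix_source s u \<and> v = letter_count s u i"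
  by (simp add: prefix_route_eq mem_value_route)

text \<open>Letters below the source are not partially placed, so their counts are 0 or full and
  give bumps and dips.\<close>

lemma prefix_route_in_routes:
  assumes "\<And>a. 1 \<le> a \<Longrightarrow> a \<le> length s \<Longrightarrow> count_list u a \<le> comp_part s a"
  shows "prefix_route s u \<in> routes s"
proof -
  have "letter_count s u i = 0 \<or> letter_count s u i = comp_part s i"
    if "1 \<le> i" "i < prefix_source s u" for i
  proof -
    have i: "i \<le> length s" using prefix_source(2)[of s u] that by simp
    then have "\<not> partially_placed s u i" using prefix_source_le[of i s u] that by auto
    then show ?thesis using assms[OF that(1) i] i by (auto simp: partially_placed_def letter_count_def)
  qed
  then have "route_values s (letter_count s u) (prefix_source s u)"
    using prefix_source[of s u] by (auto simp: route_values_def partially_placed_def)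
  then show ?thesis unfolding prefix_route_eq routes_eq by blast
qed

section \<open>Letter counts along the prefixes of a word\<close>

lemma count_list_take_mono: "i \<le> j \<Longrightarrow> count_list (take i w) a \<le> count_list (take j w) a"
  by (metis count_list_append le_add1 le_add_diff_inverse take_add)

lemma count_list_take_le: "count_list (take i w) a \<le> count_list w a"
  by (metis append_take_drop_id count_list_append le_add1)

lemma count_list_take_Suc:
  "i < length w \<Longrightarrow> count_list (take (Suc i) w) a = count_list (take i w) a + (if w ! i = a then 1 else 0)"
  by (simp add: take_Suc_conv_app_nth)

lemma count_list_take_const:
  assumes "i \<le> j" "j \<le> length w" "\<And>m. i \<le> m \<Longrightarrow> m < j \<Longrightarrow> w ! m \<noteq> a"
  shows "count_list (take j w) a = count_list (take i w) a"
  using assms by (induction j rule: dec_induct) (auto simp: count_list_take_Suc)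

lemma letter_count_mono: "i \<le> j \<Longrightarrow> letter_count s (take i w) a \<le> letter_count s (take j w) a"
  by (simp add: letter_count_def count_list_take_mono)

section \<open>Stirling permutations and the sources of their prefixes\<close>

lemma stirling_count: "w \<in> stirling_perms s \<Longrightarrow> 1 \<le> a \<Longrightarrow> a \<le> length s \<Longrightarrow> count_list w a = comp_part s a"
  by (auto simp: stirling_perms_def)

lemma stirling_nth:
  assumes "w \<in> stirling_perms s" "i < length w"
  shows "1 \<le> w ! i" "w ! i \<le> length s"
  using subsetD[OF _ nth_mem[OF assms(2)], of "{1..length s}"] assms(1)
  by (auto simp: stirling_perms_def)

lemma length_stirling:
  assumes "w \<in> stirling_perms s"
  shows "length w = sum_list s"
proof -
  have "length w = (\<Sum>a\<in>{1..length s}. count_list w a)"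
    using assms by (subst sum_count_set) (auto simp: stirling_perms_def)
  then show ?thesis using assms sum_comp_part[of s] by (simp add: stirling_perms_def)
qed

lemma stirling_take_count:
  "w \<in> stirling_perms s \<Longrightarrow> 1 \<le> a \<Longrightarrow> a \<le> length s \<Longrightarrow> count_list (take i w) a \<le> comp_part s a"
  using count_list_take_le[of i w a] by (simp add: stirling_count)

text \<open>Avoiding 121 means that no letter is placed while a smaller one is partially placed.\<close>

lemma stirling_nth_le_source:
  assumes w: "w \<in> stirling_perms s" and i: "i < length w"
  shows "w ! i \<le> prefix_source s (take i w)"
proof (rule ccontr)
  define c where "c = prefix_source s (take i w)"
  assume "\<not> w ! i \<le> prefix_source s (take i w)"
  then have c: "c < w ! i" by (simp add: c_def)
  have cn: "1 \<le> c" "c \<le> length s"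
    using c stirling_nth[OF w i] prefix_source(1)[of s "take i w"] by (auto simp: c_def)
  have "partially_placed s (take i w) c" unfolding c_def by (rule prefix_source)
  then have cnt: "0 < count_list (take i w) c" "count_list (take i w) c < count_list w c"
    using cn stirling_count[OF w cn] by (auto simp: partially_placed_def letter_count_def)
  then have "c \<in> set (take i w)" by (metis count_notin less_irrefl)
  then obtain j where j: "j < i" "w ! j = c" by (auto simp: in_set_conv_nth)
  have "count_list w c = count_list (take i w) c + count_list (drop i w) c"
    by (metis append_take_drop_id count_list_append)
  then have "c \<in> set (drop i w)" using cnt by (metis add.right_neutral count_notin less_irrefl)
  then obtain k where k: "k < length w - i" "w ! (i + k) = c" by (auto simp: in_set_conv_nth)
  have "k \<noteq> 0" using k c by (metis add.right_neutral less_irrefl)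
  then have "j < i \<and> i < i + k \<and> i + k < length w \<and> w ! j = w ! (i + k) \<and> w ! j < w ! i"
    using j k c by auto
  then show False using w unfolding stirling_perms_def by blast
qed

text \<open>Converse of \<open>stirling_nth_le_source\<close>: in a pattern 121 the outer letter is
  partially placed when the inner one is added, so the source would be smaller than the added
  letter.\<close>

lemma stirling_permsI:
  assumes "set w \<subseteq> {1..length s}" and cnt: "\<And>a. a \<in> {1..length s} \<Longrightarrow> count_list w a = comp_part s a"
    and src: "\<And>i. i < length w \<Longrightarrow> w ! i \<le> prefix_source s (take i w)"
  shows "w \<in> stirling_perms s"
proof -
  have False if ijk: "i < j" "j < k" "k < length w" "w ! i = w ! k" "w ! i < w ! j" for i j k
  proof -
    have a: "w ! i \<in> {1..length s}" using subsetD[OF assms(1) nth_mem, of i] ijk by auto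
    have "count_list (take (Suc i) w) (w ! i) \<le> count_list (take j w) (w ! i)"
      "count_list (take (Suc k) w) (w ! i) \<le> count_list w (w ! i)"
      "count_list (take j w) (w ! i) \<le> count_list (take k w) (w ! i)"
      using ijk by (auto intro: count_list_take_mono count_list_take_le)
    then have "partially_placed s (take j w) (w ! i)"
      using ijk a cnt[OF a] by (auto simp: partially_placed_def letter_count_def count_list_take_Suc)
    then have "prefix_source s (take j w) \<le> w ! i" using a by (intro prefix_source_le) auto
    then show False using src[of j] ijk by auto
  qed
  then show ?thesis using assms(1) cnt unfolding stirling_perms_def by blast
qed

lemma letter_count_take_Suc:
  assumes "w \<in> stirling_perms s" "i < length w"
  shows "letter_count s (take (Suc i) w) p = letter_count s (take i w) p + (if w ! i = p then 1 else 0)"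
  using stirling_nth[OF assms] assms(2) by (auto simp: letter_count_def count_list_take_Suc)

lemma partially_placed_take_Suc:
  assumes "w \<in> stirling_perms s" "i < length w" "p \<noteq> w ! i"
  shows "partially_placed s (take (Suc i) w) p \<longleftrightarrow> partially_placed s (take i w) p"
  using assms(3) by (simp add: partially_placed_def letter_count_take_Suc[OF assms(1,2)])

text \<open>No smaller letter is partially placed before the step, and placing \<open>w ! i\<close>
  leaves the smaller ones untouched. Hence the routes before and after the step both visit level
  \<open>w ! i\<close>.\<close>

lemma stirling_nth_le_source_Suc:
  assumes w: "w \<in> stirling_perms s" and i: "i < length w"
  shows "w ! i \<le> prefix_source s (take (Suc i) w)"
proof (rule prefix_source_ge)
  fix p assume p: "1 \<le> p" "p < w ! i"
  then have "\<not> partially_placed s (take i w) p"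
    using prefix_source_le[of p s "take i w"] stirling_nth[OF w i] stirling_nth_le_source[OF w i]
    by fastforce
  then show "\<not> partially_placed s (take (Suc i) w) p"
    using p by (simp add: partially_placed_take_Suc[OF w i])
qed (use stirling_nth[OF w i] in auto)

text \<open>While the letter \<open>a\<close> is partially placed, only letters up to \<open>a\<close> are placed.\<close>

lemma letter_count_between:
  assumes w: "w \<in> stirling_perms s" and a: "1 \<le> a" "a \<le> length s"
    and ij: "i \<le> j" "j \<le> length w" "a < p"
    and part: "\<And>m. i \<le> m \<Longrightarrow> m < j \<Longrightarrow> w ! m \<noteq> a \<Longrightarrow> partially_placed s (take m w) a"
  shows "letter_count s (take j w) p = letter_count s (take i w) p"
proof -
  have "w ! m \<noteq> p" if m: "i \<le> m" "m < j" for m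
  proof (cases "w ! m = a")
    case False
    then have "prefix_source s (take m w) \<le> a" using part[OF m] a by (intro prefix_source_le) auto
    then show ?thesis using stirling_nth_le_source[OF w, of m] m ij by auto
  qed (use ij in auto)
  then have "count_list (take j w) p = count_list (take i w) p"
    using ij by (intro count_list_take_const) auto
  then show ?thesis by (simp add: letter_count_def)
qed

section \<open>The simplices \<open>\<Delta>\<^sub>w\<close>\<close>

lemma Delta_subset_routes: "w \<in> stirling_perms s \<Longrightarrow> Delta s w \<subseteq> routes s"
  by (auto simp: Delta_def intro!: prefix_route_in_routes stirling_take_count)

lemma Delta_nonempty: "Delta s w \<noteq> {}"
  by (simp add: Delta_def)

text \<open>Letter counts grow along the prefixes, so any two of these routes are comparable by
  \<open>route_le\<close>.\<close>

lemma coherent_Delta: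
  assumes "w \<in> stirling_perms s"
  shows "pairwise (coherent s) (Delta s w)"
proof -
  have *: "coherent s (prefix_route s (take i w)) (prefix_route s (take j w))" if "i \<le> j" for i j
    using that assms
    by (intro route_le_imp_coherent prefix_route_in_routes stirling_take_count)
      (auto simp: route_le_def mem_prefix_route letter_count_mono)
  show ?thesis unfolding pairwise_def Delta_def
    using * coherent_swap by (metis (no_types, lifting) imageE nat_le_linear)
qed

text \<open>Let \<open>a < b\<close> be the letters of \<open>w\<close> and \<open>w'\<close> at the
  first difference. The route of \<open>w\<close> once all copies of \<open>a\<close> are placed is
  full at \<open>a\<close> and unchanged at \<open>b\<close>. The route of \<open>w'\<close> right
  after placing \<open>b\<close> is 0 at \<open>a\<close> and larger by one at \<open>b\<close>.
  Both visit level \<open>b\<close>, so they cross.\<close>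

lemma distinct_stirling_crossing:
  assumes w: "w \<in> stirling_perms s" and w': "w' \<in> stirling_perms s"
    and i: "i < length w" "i < length w'" and pre: "take i w = take i w'" and lt: "w ! i < w' ! i"
  obtains P Q where "P \<in> Delta s w" "Q \<in> Delta s w'" "P \<noteq> Q" "\<not> coherent s P Q"
proof -
  define a b where "a = w ! i" and "b = w' ! i"
  have ab: "1 \<le> a" "a < b" "a \<le> length s" "b \<le> length s" "1 \<le> b"
    using stirling_nth[OF w i(1)] stirling_nth[OF w' i(2)] lt by (auto simp: a_def b_def)
  have bsrc: "b \<le> prefix_source s (take i w)"
    using stirling_nth_le_source[OF w' i(2)] by (simp add: b_def pre)
  have np: "\<not> partially_placed s (take i w) p" if "1 \<le> p" "p < b" for p
    using prefix_source_le[of p s "take i w"] bsrc ab that by fastforce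
  have suc: "letter_count s (take (Suc i) w) a = Suc (letter_count s (take i w) a)"
    using letter_count_take_Suc[OF w i(1), of a] by (simp add: a_def)
  have le: "letter_count s (take m w) a \<le> comp_part s a" for m
    using stirling_take_count[OF w, of a m] ab by (simp add: letter_count_def)
  \<comment> \<open>In \<open>w'\<close> the larger letter \<open>b\<close> may follow here, so
    \<open>a\<close> is not partially placed; in \<open>w\<close> a copy of \<open>a\<close> is
    still to come, so \<open>a\<close> is not full.\<close>
  have a0: "letter_count s (take i w) a = 0"
    using np[of a] ab suc le[of "Suc i"] by (auto simp: partially_placed_def)
  define full where "full = (\<lambda>m. letter_count s (take m w) a = comp_part s a)"
  define j where "j = (LEAST m. full m)"
  have "full (length w)" using ab stirling_count[OF w, of a] by (simp add: full_def letter_count_def)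
  then have j: "full j" "j \<le> length w" unfolding j_def by (auto intro: LeastI Least_le)
  have jmin: "\<not> full m" if "m < j" for m using that not_less_Least[of m full] by (simp add: j_def)
  have ij: "i < j"
  proof (rule ccontr)
    assume "\<not> i < j"
    then have "comp_part s a \<le> 0"
      using letter_count_mono[of j i s w a] j a0 by (simp add: full_def)
    then show False using suc le[of "Suc i"] by simp
  qed
  have part: "partially_placed s (take m w) a" if "i \<le> m" "m < j" "w ! m \<noteq> a" for m
  proof -
    have "Suc i \<le> m" using that by (cases "i = m") (auto simp: a_def)
    then have "0 < letter_count s (take m w) a"
      using letter_count_mono[of "Suc i" m s w a] suc by simp
    then show ?thesis using jmin[OF that(2)] le[of m] by (auto simp: partially_placed_def full_def)
  qed
  have same: "letter_count s (take j w) p = letter_count s (take i w) p" if "a < p" for p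
    using letter_count_between[OF w ab(1,3) _ j(2) that part] ij by simp
  obtain j' where j': "j = Suc j'" using ij by (cases j) auto
  have j'w: "j' < length w" using j j' by simp
  have last: "w ! j' = a"
  proof (rule ccontr)
    assume "w ! j' \<noteq> a"
    then have "full j'" using j(1) letter_count_take_Suc[OF w j'w, of a] by (simp add: full_def j')
    then show False using jmin[of j'] j' by simp
  qed
  \<comment> \<open>Letters below \<open>a\<close> are not partially placed because the last letter
    placed is \<open>a\<close>; the letter \<open>a\<close> is full; those between \<open>a\<close>
    and \<open>b\<close> have the same counts as at position \<open>i\<close>.\<close>
  have bj: "b \<le> prefix_source s (take j w)"
  proof (rule prefix_source_ge)
    fix p assume p: "1 \<le> p" "p < b"
    consider "p < a" | "p = a" | "a < p" by linarith
    then show "\<not> partially_placed s (take j w) p"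
    proof cases
      case 1
      then show ?thesis
        using stirling_nth_le_source_Suc[OF w j'w] last p prefix_source_le[of p s "take j w"] ab j'
        by fastforce
    next
      case 2
      then show ?thesis using j(1) by (simp add: full_def partially_placed_def)
    next
      case 3
      then show ?thesis using np[OF p] same by (simp add: partially_placed_def)
    qed
  qed (use ab in auto)
  have bi: "b \<le> prefix_source s (take (Suc i) w')"
    using stirling_nth_le_source_Suc[OF w' i(2)] by (simp add: b_def)
  let ?P = "prefix_route s (take j w)" and ?Q = "prefix_route s (take (Suc i) w')"
  have mem: "?P \<in> Delta s w" "?Q \<in> Delta s w'"
    using j(2) i(2) length_stirling[OF w] length_stirling[OF w'] by (auto simp: Delta_def)
  have P: "(a, comp_part s a) \<in> set ?P" "(b, letter_count s (take i w) b) \<in> set ?P"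
    using bj ab j(1) same[of b] by (auto simp: mem_prefix_route full_def)
  have Q: "(a, 0) \<in> set ?Q" "(b, Suc (letter_count s (take i w) b)) \<in> set ?Q"
    using bi ab a0 letter_count_take_Suc[OF w' i(2), of a] letter_count_take_Suc[OF w' i(2), of b]
    by (auto simp: mem_prefix_route b_def pre)
  have pos: "0 < comp_part s a" using suc le[of "Suc i"] by simp
  have "\<not> coherent s ?P ?Q"
  proof
    assume "coherent s ?P ?Q"
    then show False
      using coherent_crossing[of ?P s ?Q, OF _ _ _ P(2) Q(2) _ P(1) Q(1)] pos mem
        Delta_subset_routes[OF w] Delta_subset_routes[OF w'] by blast
  qed
  moreover have "?P \<noteq> ?Q"
  proof
    assume "?P = ?Q"
    then show False using P(1) Q(1) pos by (auto simp: mem_prefix_route)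
  qed
  ultimately show ?thesis using mem that by blast
qed

lemma Delta_union_coherent_imp_eq:
  assumes w: "w \<in> stirling_perms s" and w': "w' \<in> stirling_perms s"
    and coh: "pairwise (coherent s) (Delta s w \<union> Delta s w')"
  shows "w = w'"
proof (rule ccontr)
  assume "w \<noteq> w'"
  have len: "length w = length w'" using length_stirling[OF w] length_stirling[OF w'] by simp
  then have ex: "\<exists>i. i < length w \<and> w ! i \<noteq> w' ! i" using \<open>w \<noteq> w'\<close> nth_equalityI by blast
  define i where "i = (LEAST i. i < length w \<and> w ! i \<noteq> w' ! i)"
  have i: "i < length w" "w ! i \<noteq> w' ! i" using LeastI_ex[OF ex] by (auto simp: i_def)
  have "w ! m = w' ! m" if "m < i" for m
    using not_less_Least[of m "\<lambda>i. i < length w \<and> w ! i \<noteq> w' ! i"] that i by (auto simp: i_def)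
  then have pre: "take i w = take i w'" using i len by (intro nth_equalityI) auto
  consider "w ! i < w' ! i" | "w' ! i < w ! i" using i by linarith
  then show False
  proof cases
    case 1
    then obtain P Q where "P \<in> Delta s w" "Q \<in> Delta s w'" "P \<noteq> Q" "\<not> coherent s P Q"
      using distinct_stirling_crossing[OF w w' i(1) _ pre] i len by metis
    then show False using coh by (auto simp: pairwise_def)
  next
    case 2
    then obtain P Q where "P \<in> Delta s w'" "Q \<in> Delta s w" "P \<noteq> Q" "\<not> coherent s P Q"
      using distinct_stirling_crossing[OF w' w _ i(1) pre[symmetric]] i len by metis
    then show False using coh by (auto simp: pairwise_def)
  qed
qed

section \<open>Every coherent set of routes lies in some \<open>\<Delta>\<^sub>w\<close>\<close>

definition route_below :: "(nat \<Rightarrow> nat) \<Rightarrow> edge list \<Rightarrow> bool" where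
  "route_below f R \<longleftrightarrow> (\<forall>i v. (i, v) \<in> set R \<longrightarrow> v \<le> f i)"

definition route_above :: "(nat \<Rightarrow> nat) \<Rightarrow> edge list \<Rightarrow> bool" where
  "route_above f R \<longleftrightarrow> (\<forall>i v. (i, v) \<in> set R \<longrightarrow> f i \<le> v)"

lemma letter_count_snoc:
  "1 \<le> a \<Longrightarrow> a \<le> length s \<Longrightarrow>
    letter_count s (u @ [a]) p = letter_count s u p + (if p = a then 1 else 0)"
  by (auto simp: letter_count_def)

lemma exists_unfinished_letter:
  assumes "set u \<subseteq> {1..length s}" "length u < sum_list s"
  shows "\<exists>a. 1 \<le> a \<and> a \<le> length s \<and> count_list u a < comp_part s a"
proof (rule ccontr)
  assume "\<not> ?thesis"
  then have "comp_part s a \<le> count_list u a" if "a \<in> {1..length s}" for a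
    using that by (meson atLeastAtMost_iff leI)
  then have "sum_list s \<le> (\<Sum>a\<in>{1..length s}. count_list u a)"
    unfolding sum_comp_part[symmetric] by (rule sum_mono)
  also have "\<dots> = length u" using assms(1) by (intro sum_count_set) auto
  finally show False using assms(2) by simp
qed

text \<open>A route below the counts stays below whatever letter is added, so only the set
  \<open>U\<close> of routes exceeding the counts somewhere restricts the choice. If
  \<open>U\<close> is empty, the least unfinished letter will do. Otherwise each route of
  \<open>U\<close> has a lowest level where it exceeds the counts, and the largest of these levels
  is the next letter.\<close>

lemma extend_prefix:
  assumes S: "S \<subseteq> routes s" "pairwise (coherent s) S"
    and u: "set u \<subseteq> {1..length s}" "length u < sum_list s"
    and sep: "\<And>R. R \<in> S \<Longrightarrow> route_below (letter_count s u) R \<or> route_above (letter_count s u) R"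
  obtains a where "1 \<le> a" "a \<le> length s" "count_list u a < comp_part s a" "a \<le> prefix_source s u"
    "\<And>R. R \<in> S \<Longrightarrow>
      route_below (letter_count s (u @ [a])) R \<or> route_above (letter_count s (u @ [a])) R"
proof -
  define U where "U = {R \<in> S. \<not> route_below (letter_count s u) R}"
  have up: "route_below (letter_count s (u @ [a])) R"
    if "route_below (letter_count s u) R" "1 \<le> a" "a \<le> length s" for R a
    using that by (auto simp: route_below_def letter_count_snoc intro: le_SucI)
  show ?thesis
  proof (cases "U = {}")
    case True
    define a where "a = (LEAST a. 1 \<le> a \<and> a \<le> length s \<and> count_list u a < comp_part s a)"
    have a: "1 \<le> a" "a \<le> length s" "count_list u a < comp_part s a"
      using LeastI_ex[OF exists_unfinished_letter[OF u(1,2)]] by (auto simp: a_def)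
    have "a \<le> prefix_source s u"
    proof (rule prefix_source_ge)
      fix p assume p: "1 \<le> p" "p < a"
      then have "\<not> count_list u p < comp_part s p"
        using not_less_Least[of p "\<lambda>a. 1 \<le> a \<and> a \<le> length s \<and> count_list u a < comp_part s a"] a
        by (auto simp: a_def)
      then show "\<not> partially_placed s u p" using p a
        by (auto simp: partially_placed_def letter_count_def)
    qed (use a in auto)
    moreover have "route_below (letter_count s (u @ [a])) R" if "R \<in> S" for R
      using that True up a by (auto simp: U_def)
    ultimately show ?thesis using that a by blast
  next
    case False
    define d where "d = (\<lambda>R. LEAST i. \<exists>v. (i, v) \<in> set R \<and> letter_count s u i < v)"
    have d: "\<exists>v. (d R, v) \<in> set R \<and> letter_count s u (d R) < v" if "R \<in> U" for R
    proof -
      have "\<exists>i v. (i, v) \<in> set R \<and> letter_count s u i < v"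
        using that by (auto simp: U_def route_below_def not_le)
      from LeastI_ex[OF this] show ?thesis unfolding d_def .
    qed
    have dmin: "v \<le> letter_count s u i" if "i < d R" "(i, v) \<in> set R" for R i v
      using not_less_Least[OF that(1)[unfolded d_def]] that(2) by (meson not_le)
    have above: "route_above (letter_count s u) R" if "R \<in> U" for R
      using that sep by (auto simp: U_def)
    have finU: "finite U" using finite_subset[OF S(1) finite_routes] by (simp add: U_def)
    \<comment> \<open>A route of \<open>U\<close> that still has the current count at \<open>a\<close> exceeds the counts first at a
      smaller letter, hence crosses a route attaining the maximum.\<close>
    define a where "a = Max (d ` U)"
    have "a \<in> d ` U" unfolding a_def using finU False by (intro Max_in) auto
    then obtain Q where Q: "Q \<in> U" "d Q = a" by auto
    have amax: "d R \<le> a" if "R \<in> U" for R unfolding a_def using finU that by (intro Max_ge) auto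
    have "Q \<in> routes s" using Q S(1) by (auto simp: U_def)
    then obtain f k where f: "Q = value_route f k" "route_values s f k" by (rule routesE)
    have a: "1 \<le> a" "a \<le> k" "letter_count s u a < f a"
      using d[OF Q(1)] Q(2) f(1) by (auto simp: mem_value_route)
    have eq: "f p = letter_count s u p" if "1 \<le> p" "p < a" for p
    proof -
      have "(p, f p) \<in> set Q" using that a f(1) by (simp add: mem_value_route)
      then show ?thesis using dmin[of p Q "f p"] above[OF Q(1)] that Q(2)
        by (auto simp: route_above_def intro: le_antisym)
    qed
    have flat: "f p = 0 \<or> f p = comp_part s p" if "1 \<le> p" "p < k" for p
      using f(2) that by (auto simp: route_values_def)
    have k: "k \<le> length s + 1" "f k < comp_part s k" using f(2) by (auto simp: route_values_def)
    \<comment> \<open>At level n+1 the only value of a route is 1, which equals the count there and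
      cannot exceed it.\<close>
    have an: "a \<le> length s"
    proof (rule ccontr)
      assume "\<not> a \<le> length s"
      then have "a = Suc (length s)" "k = a" using a k by auto
      then show False using a k by (simp add: comp_part_last letter_count_def)
    qed
    have "f a \<le> comp_part s a" using flat[of a] a k by (cases "a = k") auto
    then have cnt: "count_list u a < comp_part s a" using a an by (simp add: letter_count_def)
    \<comment> \<open>Below \<open>a\<close> the counts are values of \<open>Q\<close> below its
      source, hence 0 or full.\<close>
    have src: "a \<le> prefix_source s u"
    proof (rule prefix_source_ge)
      fix p assume "1 \<le> p" "p < a"
      then show "\<not> partially_placed s u p"
        using eq[of p] flat[of p] a by (auto simp: partially_placed_def)
    qed (use an in auto)
    have "route_above (letter_count s (u @ [a])) R" if R: "R \<in> U" for R
    proof -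
      have "letter_count s u a \<noteq> v" if v: "(a, v) \<in> set R" for v
      proof
        assume lv: "letter_count s u a = v"
        have RQ: "R \<in> routes s" "Q \<in> routes s" "R \<in> S" "Q \<in> S" using R Q S(1) by (auto simp: U_def)
        obtain g l where g: "R = value_route g l" "route_values s g l" using RQ(1) by (rule routesE)
        have gd: "1 \<le> d R" "d R \<le> l" "letter_count s u (d R) < g (d R)"
          using d[OF R] by (auto simp: g mem_value_route)
        have ga: "g a = v" "a \<le> l" using v by (auto simp: g mem_value_route)
        have "d R \<noteq> a" using gd ga lv by auto
        then have da: "d R < a" using amax[OF R] by simp
        have "R \<noteq> Q"
        proof
          assume "R = Q"
          then have "(a, f a) \<in> set R" using a f by (simp add: mem_value_route)
          then show False using ga lv a g by (simp add: mem_value_route)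
        qed
        then have coh: "coherent s R Q" using S(2) RQ by (simp add: pairwise_def)
        show False
          using coherent_crossing[OF RQ(1,2) coh, of a v "f a" "d R" "g (d R)" "f (d R)"]
            v a f(1) da gd g(1) eq[of "d R"] lv by (simp add: mem_value_route)
      qed
      then show ?thesis
        using above[OF R] a an by (fastforce simp: route_above_def letter_count_snoc)
    qed
    then have "route_below (letter_count s (u @ [a])) R \<or> route_above (letter_count s (u @ [a])) R"
      if "R \<in> S" for R
      using that up a an by (auto simp: U_def)
    then show ?thesis using that a an cnt src by blast
  qed
qed

lemma separating_prefix:
  assumes S: "S \<subseteq> routes s" "pairwise (coherent s) S" and m: "m \<le> sum_list s"
  shows "\<exists>u. length u = m \<and> set u \<subseteq> {1..length s} \<and>
    (\<forall>a\<in>{1..length s}. count_list u a \<le> comp_part s a) \<and>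
    (\<forall>i<m. u ! i \<le> prefix_source s (take i u)) \<and>
    (\<forall>i\<le>m. \<forall>R\<in>S. route_below (letter_count s (take i u)) R \<or>
      route_above (letter_count s (take i u)) R)"
  using m
proof (induction m)
  case 0
  \<comment> \<open>All counts are 0 except at level n+1, where the count 1 does not exceed the
    positive value of a source-edge.\<close>
  have "route_above (letter_count s []) R" if "R \<in> S" for R
  proof -
    have "R \<in> routes s" using S(1) that by auto
    then obtain f k where f: "R = value_route f k" "route_values s f k" by (rule routesE)
    have "letter_count s [] i \<le> f i" if "i \<le> k" for i
      using f(2) that by (cases "i = k") (auto simp: route_values_def letter_count_def)
    then show ?thesis by (simp add: route_above_def f mem_value_route)
  qed
  then show ?case by auto
next
  case (Suc m)
  then obtain u where u: "length u = m" "set u \<subseteq> {1..length s}"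
    "\<forall>a\<in>{1..length s}. count_list u a \<le> comp_part s a"
    "\<forall>i<m. u ! i \<le> prefix_source s (take i u)"
    "\<forall>i\<le>m. \<forall>R\<in>S. route_below (letter_count s (take i u)) R \<or>
      route_above (letter_count s (take i u)) R"
    by auto
  have sep: "route_below (letter_count s u) R \<or> route_above (letter_count s u) R" if "R \<in> S" for R
    using u(1) u(5)[rule_format, OF order_refl that] by simp
  obtain a where a: "1 \<le> a" "a \<le> length s" "count_list u a < comp_part s a" "a \<le> prefix_source s u"
    "\<And>R. R \<in> S \<Longrightarrow>
      route_below (letter_count s (u @ [a])) R \<or> route_above (letter_count s (u @ [a])) R"
    by (rule extend_prefix[OF S u(2) _ sep]) (use u Suc.prems in auto)
  show ?case
  proof (intro exI[of _ "u @ [a]"] conjI allI impI ballI)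
    fix i assume "i < Suc m"
    then show "(u @ [a]) ! i \<le> prefix_source s (take i (u @ [a]))"
      using u a by (cases "i = m") (auto simp: nth_append)
  next
    fix i R assume "i \<le> Suc m" "R \<in> S"
    then show "route_below (letter_count s (take i (u @ [a]))) R \<or>
        route_above (letter_count s (take i (u @ [a]))) R"
      using u(1,5) a(5) by (cases "i = Suc m") (auto simp: le_Suc_eq)
  next
    fix b assume "b \<in> {1..length s}"
    then show "count_list (u @ [a]) b \<le> comp_part s b" using u(3) a by (auto intro: Suc_leI)
  qed (use u a in auto)
qed

text \<open>Take the longest prefix whose counts do not exceed \<open>R\<close>. After one more
  letter the counts exceed \<open>R\<close> somewhere, necessarily at that letter, so
  \<open>R\<close> lies below the new counts. As only this one count changed, and by one,
  \<open>R\<close> has exactly the counts of the chosen prefix as its values.\<close>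

lemma route_in_Delta:
  assumes w: "w \<in> stirling_perms s" and R: "R \<in> routes s"
    and sep: "\<And>i. i \<le> sum_list s \<Longrightarrow>
      route_below (letter_count s (take i w)) R \<or> route_above (letter_count s (take i w)) R"
  shows "R \<in> Delta s w"
proof -
  obtain f k where f: "R = value_route f k" "route_values s f k" using R by (rule routesE)
  have k: "1 \<le> k" "k \<le> length s + 1" "0 < f k" "f k < comp_part s k"
    using f(2) by (auto simp: route_values_def)
  have flat: "f p = 0 \<or> f p = comp_part s p" if "1 \<le> p" "p < k" for p
    using f(2) that by (auto simp: route_values_def)
  have len: "length w = sum_list s" by (rule length_stirling[OF w])
  let ?A = "\<lambda>i. i \<le> sum_list s \<and> route_above (letter_count s (take i w)) R"
  have "letter_count s [] i \<le> f i" if "i \<le> k" for i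
    using k that by (cases "i = k") (auto simp: letter_count_def)
  then have A0: "?A 0" by (simp add: route_above_def f mem_value_route)
  define i where "i = (GREATEST i. ?A i)"
  have Ai: "?A i" unfolding i_def by (rule GreatestI_nat[of ?A 0 "sum_list s"]) (use A0 in auto)
  have gr: "\<not> ?A (Suc i)"
    using Greatest_le_nat[of ?A "Suc i" "sum_list s"] by (auto simp: i_def)
  have ab: "letter_count s (take i w) p \<le> f p" if "1 \<le> p" "p \<le> k" for p
    using Ai that by (simp add: route_above_def f mem_value_route)
  have eq: "f p = letter_count s (take i w) p" if p: "1 \<le> p" "p \<le> k" for p
  proof (cases "i = sum_list s")
    case True
    \<comment> \<open>For the whole word all letters are full, and the value of a source-edge is
      less than its part, so \<open>R\<close> can only start at level n+1.\<close>
    have full: "letter_count s (take i w) q = comp_part s q" if "1 \<le> q" "q \<le> length s" for q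
      using stirling_count[OF w that] that len True by (simp add: letter_count_def)
    have "k = length s + 1" using full[of k] ab[of k] k by fastforce
    then show ?thesis using full[of p] ab[of p] flat[of p] p k
      by (cases "p = k") (auto simp: comp_part_last letter_count_def)
  next
    case False
    then have i: "i < length w" using Ai len by auto
    then have si: "Suc i \<le> sum_list s" using len by simp
    have na: "\<not> route_above (letter_count s (take (Suc i) w)) R" using gr si by blast
    then have "route_below (letter_count s (take (Suc i) w)) R" using sep[OF si] by blast
    then have "f q \<le> letter_count s (take (Suc i) w) q" if "1 \<le> q" "q \<le> k" for q
      using that by (simp add: route_below_def f mem_value_route)
    then have be: "f q \<le> letter_count s (take i w) q + (if w ! i = q then 1 else 0)"
      if "1 \<le> q" "q \<le> k" for q
      using that by (simp only: letter_count_take_Suc[OF w i])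
    obtain q where q: "1 \<le> q" "q \<le> k" "f q < letter_count s (take (Suc i) w) q"
      using na by (auto simp: route_above_def f mem_value_route not_le)
    then have "q = w ! i" "f q \<le> letter_count s (take i w) q"
      using letter_count_take_Suc[OF w i, of q] ab[of q] by (auto split: if_splits)
    then show ?thesis using be[OF p] ab[OF p] by (cases "p = q") auto
  qed
  have src: "prefix_source s (take i w) = k"
    using k eq[of k] flat eq
    by (intro prefix_source_eqI) (fastforce simp: partially_placed_def)+
  have "prefix_route s (take i w) = R"
    unfolding prefix_route_eq src f(1) by (rule value_route_cong) (simp add: eq)
  then show ?thesis using Ai by (auto simp: Delta_def)
qed

lemma coherent_subset_Delta:
  assumes S: "S \<subseteq> routes s" "pairwise (coherent s) S"
  obtains w where "w \<in> stirling_perms s" "S \<subseteq> Delta s w"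
proof -
  obtain w where w: "length w = sum_list s" "set w \<subseteq> {1..length s}"
    "\<forall>a\<in>{1..length s}. count_list w a \<le> comp_part s a"
    "\<forall>i<sum_list s. w ! i \<le> prefix_source s (take i w)"
    "\<forall>i\<le>sum_list s. \<forall>R\<in>S. route_below (letter_count s (take i w)) R \<or>
      route_above (letter_count s (take i w)) R"
    using separating_prefix[OF S order_refl] by auto
  \<comment> \<open>The counts are bounded by the parts and have the same total, so they agree one
    by one.\<close>
  have "(\<Sum>a\<in>{1..length s}. count_list w a) = (\<Sum>a\<in>{1..length s}. comp_part s a)"
    using w(1,2) sum_count_set[of w "{1..length s}"] by (simp add: sum_comp_part[symmetric])
  then have "count_list w a = comp_part s a" if "a \<in> {1..length s}" for a
    using sum_mono_inv[of "count_list w" "{1..length s}" "comp_part s" a] w(3) that by auto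
  then have st: "w \<in> stirling_perms s" using w by (intro stirling_permsI) auto
  moreover have "S \<subseteq> Delta s w" using route_in_Delta[OF st] S(1) w(5) by blast
  ultimately show ?thesis by (rule that)
qed

section \<open>The coordinates of an associated point\<close>

lemma positions_snoc:
  "filter (\<lambda>i. (w @ [x]) ! i = a) [0..<length (w @ [x])] =
    filter (\<lambda>i. w ! i = a) [0..<length w] @ (if x = a then [length w] else [])"
proof -
  have "filter (\<lambda>i. (w @ [x]) ! i = a) [0..<length w] = filter (\<lambda>i. w ! i = a) [0..<length w]"
    by (rule filter_cong) (auto simp: nth_append)
  then show ?thesis by (auto simp del: upt_Suc simp: upt_Suc_append)
qed

lemma length_positions: "length (filter (\<lambda>i. w ! i = a) [0..<length w]) = count_list w a"
proof (induction w rule: rev_induct)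
  case (snoc x w)
  show ?case unfolding positions_snoc using snoc by simp
qed simp

lemma occ_prefix:
  assumes "1 \<le> t" "t \<le> count_list w a"
  shows "occ_prefix w a t < length w" "w ! occ_prefix w a t = a"
    "count_list (take (occ_prefix w a t) w) a = t - 1"
proof -
  have "occ_prefix w a t < length w \<and> w ! occ_prefix w a t = a \<and>
    count_list (take (occ_prefix w a t) w) a = t - 1"
    using assms(2)
  proof (induction w rule: rev_induct)
    case (snoc x w)
    show ?case
    proof (cases "t \<le> count_list w a")
      case True
      then have "occ_prefix (w @ [x]) a t = occ_prefix w a t"
        using assms(1) True unfolding occ_prefix_def positions_snoc
        by (subst nth_append) (auto simp: length_positions)
      then show ?thesis using snoc.IH[OF True] by (simp add: nth_append)
    next
      case False
      then have "x = a" "t = Suc (count_list w a)" using snoc.prems by (auto split: if_splits)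
      moreover from this have "occ_prefix (w @ [x]) a t = length w"
        unfolding occ_prefix_def positions_snoc by (subst nth_append) (simp add: length_positions)
      ultimately show ?thesis by simp
    qed
  qed (use assms(1) in simp)
  then show "occ_prefix w a t < length w" "w ! occ_prefix w a t = a"
    "count_list (take (occ_prefix w a t) w) a = t - 1" by auto
qed

text \<open>The source of the prefix \<open>u\<close> in case no letter up to \<open>a\<close> is
  partially placed.\<close>

definition source_above :: "nat list \<Rightarrow> nat \<Rightarrow> nat list \<Rightarrow> nat" where
  "source_above s a u = Min {p \<in> {a<..length s + 1}. partially_placed s u p}"

text \<open>The part of the route weight above level \<open>a\<close> in that case. It depends only
  on the counts of letters larger than \<open>a\<close>.\<close>

definition upper_weight :: "(edge \<Rightarrow> real) \<Rightarrow> nat list \<Rightarrow> nat \<Rightarrow> nat list \<Rightarrow> real" where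
  "upper_weight \<omega> s a u = (\<Sum>p\<in>{a<..source_above s a u}. \<omega> (p, letter_count s u p))"

lemma upper_weight_cong:
  assumes "\<And>p. a < p \<Longrightarrow> letter_count s u p = letter_count s u' p"
  shows "upper_weight \<omega> s a u = upper_weight \<omega> s a u'"
proof -
  have "source_above s a u = source_above s a u'"
    using assms by (auto simp: source_above_def partially_placed_def intro!: arg_cong[where f = Min])
  then show ?thesis unfolding upper_weight_def using assms by (auto intro: sum.cong)
qed

text \<open>No letter below \<open>a\<close> is partially placed. If \<open>a\<close> is, the route
  starts at level \<open>a\<close> and has no edges above; otherwise it starts at
  \<open>source_above s a u\<close>.\<close>

lemma prefix_route_weight:
  assumes a: "1 \<le> a" "a \<le> length s" "a \<le> prefix_source s u"
  shows "(\<Sum>e\<in>set (prefix_route s u). \<omega> e) =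
    (\<Sum>p\<in>{1..<a}. \<omega> (p, letter_count s u p)) + \<omega> (a, letter_count s u a) +
    (if partially_placed s u a then 0 else upper_weight \<omega> s a u)"
proof -
  let ?g = "\<lambda>p. \<omega> (p, letter_count s u p)"
  have 1: "(\<Sum>e\<in>set (prefix_route s u). \<omega> e) = (\<Sum>p\<in>{1..prefix_source s u}. ?g p)"
    unfolding prefix_route_eq set_value_route by (subst sum.reindex) (auto simp: inj_on_def)
  have 2: "(\<Sum>p\<in>{1..a}. ?g p) = (\<Sum>p\<in>{1..<a}. ?g p) + ?g a"
    using a(1) by (simp add: sum.last_plus)
  show ?thesis
  proof (cases "partially_placed s u a")
    case True
    then have "prefix_source s u = a" using prefix_source_le[of a s u] a by simp
    then show ?thesis using 1 2 True by simp
  next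
    case False
    have np: "\<not> partially_placed s u p" if "1 \<le> p" "p < a" for p
      using prefix_source_le[of p s u] a that by fastforce
    let ?M = "{p \<in> {a<..length s + 1}. partially_placed s u p}"
    have "source_above s a u \<in> ?M"
      unfolding source_above_def using partially_placed_last[of s u] a by (intro Min_in) auto
    moreover have "\<not> partially_placed s u p" if "1 \<le> p" "p < source_above s a u" for p
    proof
      assume pp: "partially_placed s u p"
      then have "a < p" using np[of p] False that by (metis linorder_cases)
      then have "source_above s a u \<le> p"
        unfolding source_above_def using pp that \<open>source_above s a u \<in> ?M\<close> by (intro Min_le) auto
      then show False using that by simp
    qed
    ultimately have src: "prefix_source s u = source_above s a u" "a < source_above s a u"
      by (auto intro!: prefix_source_eqI)
    then have "{1..prefix_source s u} = {1..a} \<union> {a<..source_above s a u}" using a by auto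
    then have "(\<Sum>p\<in>{1..prefix_source s u}. ?g p) = (\<Sum>p\<in>{1..a}. ?g p) + upper_weight \<omega> s a u"
      unfolding upper_weight_def by (simp only:) (rule sum.union_disjoint, auto)
    then show ?thesis using 1 2 False by simp
  qed
qed

text \<open>Placing the \<open>t\<close>-th copy of \<open>a\<close> changes no other count, and no
  larger letter is placed between the first and the last copy. So all the routes involved share one
  upper weight \<open>G\<close>, present only when \<open>a\<close> is not partially placed. Each
  summand is therefore \<open>A t - A (t - 1)\<close>, and \<open>G\<close> cancels between
  \<open>A (comp_part s a)\<close> and \<open>A 0\<close>.\<close>

lemma telescoping_weights:
  fixes \<omega> :: "edge \<Rightarrow> real"
  assumes w: "w \<in> stirling_perms s" and a: "1 \<le> a" "a \<le> length s" and pos: "0 < comp_part s a"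
  shows "(\<Sum>t=1..comp_part s a. (\<Sum>e\<in>set (prefix_route s (take (occ_prefix w a t + 1) w)). \<omega> e)
      - (\<Sum>e\<in>set (prefix_route s (take (occ_prefix w a t) w)). \<omega> e))
    = \<omega> (a, comp_part s a) - \<omega> (a, 0)"
proof -
  let ?o = "occ_prefix w a"
  define G where "G = upper_weight \<omega> s a (take (?o 1) w)"
  define A where "A = (\<lambda>t. \<omega> (a, t) + (if 0 < t \<and> t < comp_part s a then 0 else G))"
  have cw: "count_list w a = comp_part s a" by (rule stirling_count[OF w a])
  have "(\<Sum>e\<in>set (prefix_route s (take (?o t + 1) w)). \<omega> e)
      - (\<Sum>e\<in>set (prefix_route s (take (?o t) w)). \<omega> e) = A t - A (t - 1)"
    if t: "t \<in> {1..comp_part s a}" for t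
  proof -
    have o: "?o t < length w" "w ! ?o t = a" "count_list (take (?o t) w) a = t - 1"
      using occ_prefix[of t w a] t cw by auto
    have o1: "?o 1 < length w" "w ! ?o 1 = a" "count_list (take (?o 1) w) a = 0"
      using occ_prefix[of 1 w a] pos cw by auto
    have ord: "?o 1 \<le> ?o t"
    proof (rule ccontr)
      assume "\<not> ?o 1 \<le> ?o t"
      then have "count_list (take (Suc (?o t)) w) a \<le> count_list (take (?o 1) w) a"
        by (intro count_list_take_mono) simp
      then show False using o o1 by (simp add: count_list_take_Suc)
    qed
    have part: "partially_placed s (take m w) a" if m: "?o 1 \<le> m" "m < ?o t" "w ! m \<noteq> a" for m
    proof -
      have "Suc (?o 1) \<le> m" using m o1 by (cases "m = ?o 1") auto
      then have "count_list (take (Suc (?o 1)) w) a \<le> count_list (take m w) a"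
        by (rule count_list_take_mono)
      moreover have "count_list (take m w) a \<le> count_list (take (?o t) w) a"
        using m by (intro count_list_take_mono) simp
      ultimately show ?thesis using o o1 a t
        by (auto simp: partially_placed_def letter_count_def count_list_take_Suc)
    qed
    have U0: "upper_weight \<omega> s a (take (?o t) w) = G"
      unfolding G_def
      using letter_count_between[OF w a ord _ _ part] o(1) by (intro upper_weight_cong) auto
    have U1: "upper_weight \<omega> s a (take (Suc (?o t)) w) = G"
      unfolding U0[symmetric]
      by (rule upper_weight_cong) (use letter_count_take_Suc[OF w o(1)] o(2) in auto)
    have lower: "(\<Sum>p\<in>{1..<a}. \<omega> (p, letter_count s (take (Suc (?o t)) w) p))
        = (\<Sum>p\<in>{1..<a}. \<omega> (p, letter_count s (take (?o t) w) p))"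
      by (rule sum.cong) (use letter_count_take_Suc[OF w o(1)] o(2) in auto)
    have c0: "letter_count s (take (?o t) w) a = t - 1" using o a by (simp add: letter_count_def)
    then have c1: "letter_count s (take (Suc (?o t)) w) a = t"
      using letter_count_take_Suc[OF w o(1), of a] o t by auto
    have s0: "a \<le> prefix_source s (take (?o t) w)"
      using stirling_nth_le_source[OF w o(1)] o(2) by simp
    have s1: "a \<le> prefix_source s (take (Suc (?o t)) w)"
      using stirling_nth_le_source_Suc[OF w o(1)] o(2) by simp
    show ?thesis
      using prefix_route_weight[OF a s0, of \<omega>] prefix_route_weight[OF a s1, of \<omega>] lower
      unfolding c0 c1 U0 U1 partially_placed_def A_def by simp
  qed
  then have "(\<Sum>t=1..comp_part s a. (\<Sum>e\<in>set (prefix_route s (take (?o t + 1) w)). \<omega> e)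
      - (\<Sum>e\<in>set (prefix_route s (take (?o t) w)). \<omega> e))
    = (\<Sum>t=1..comp_part s a. A t - A (t - 1))"
    by (rule sum.cong[OF refl])
  also have "\<dots> = A (comp_part s a) - A 0"
    using sum_telescope''[of 0 "comp_part s a" A] pos
    by (simp add: atLeastSucAtMost_greaterThanAtMost)
  also have "\<dots> = \<omega> (a, comp_part s a) - \<omega> (a, 0)" by (simp add: A_def)
  finally show ?thesis .
qed

section \<open>Points and weights\<close>

lemma route_weight:
  "1 \<le> k \<Longrightarrow> (\<Sum>e\<in>set (route s k t \<delta>). \<omega> e) = \<omega> (k, t) + (\<Sum>i\<in>{1..<k}. \<omega> (i, \<delta> i * comp_part s i))"
proof -
  assume k: "1 \<le> k"
  have "set (route s k t \<delta>) = insert (k, t) ((\<lambda>i. (i, \<delta> i * comp_part s i)) ` {1..<k})"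
    by (auto simp: route_def)
  then show ?thesis by (simp add: image_iff) (subst sum.reindex, auto simp: inj_on_def)
qed

lemma trop_min_le: "\<delta> \<in> cube k \<Longrightarrow> trop_min s h k t x \<le> trop_term s h k t x \<delta>"
  unfolding trop_min_def using finite_cube by (intro Min_le) auto

lemma in_minimizersI:
  assumes "\<delta> \<in> cube k" "\<And>\<epsilon>. \<epsilon> \<in> cube k \<Longrightarrow> trop_term s h k t x \<delta> \<le> trop_term s h k t x \<epsilon>"
  shows "\<delta> \<in> minimizers s h k t x"
proof -
  have "trop_min s h k t x = trop_term s h k t x \<delta>"
    unfolding trop_min_def using finite_cube[of k] assms by (intro Min_eqI) auto
  then show ?thesis using assms by (simp add: minimizers_def)
qed

text \<open>Normalized so that every route has nonnegative weighted height, which is 0 exactly at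
  the minimizers: the source-edge cancels the minimum over all routes through it.\<close>

definition point_weight :: "nat list \<Rightarrow> (edge list \<Rightarrow> real) \<Rightarrow> (nat \<Rightarrow>\<^sub>0 real) \<Rightarrow> edge \<Rightarrow> real" where
  "point_weight s h x = (\<lambda>(i, v). if 1 \<le> v \<and> v < comp_part s i then - trop_min s h i v x
     else if v = 0 then 0 else Poly_Mapping.lookup x i)"

lemma weighted_point_weight:
  assumes s: "composition s" and k: "k \<in> {1..length s + 1}" "t \<in> {1..comp_part s k - 1}"
    and \<delta>: "\<delta> \<in> cube k"
  shows "weighted (point_weight s h x) h (route s k t \<delta>) = trop_term s h k t x \<delta> - trop_min s h k t x"
proof -
  have "point_weight s h x (k, t) = - trop_min s h k t x" using k by (auto simp: point_weight_def)
  moreover have "point_weight s h x (i, \<delta> i * comp_part s i) = real (\<delta> i) * Poly_Mapping.lookup x i"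
    if "i \<in> {1..<k}" for i
  proof -
    have "\<delta> i = 0 \<or> \<delta> i = 1" using \<delta> that by (auto simp: cube_def PiE_iff)
    \<comment> \<open>Positivity keeps the dip distinct from the bump, whose weight is 0.\<close>
    moreover have "0 < comp_part s i" using comp_part_pos[OF s, of i] that k by auto
    ultimately show ?thesis by (auto simp: point_weight_def)
  qed
  ultimately show ?thesis
    using route_weight[of k "point_weight s h x" s t \<delta>] k by (simp add: weighted_def trop_term_def)
qed

lemma routes_minimizing_point_weight_coherent:
  assumes s: "composition s" and adm: "admissible s h"
  shows "pairwise (coherent s) {R \<in> routes s. weighted (point_weight s h x) h R = 0}"
proof -
  have "0 \<le> weighted (point_weight s h x) h R" if R: "R \<in> routes s" for R
  proof -
    obtain k t \<delta> where "R = route s k t \<delta>" "k \<in> {1..length s + 1}" "t \<in> {1..comp_part s k - 1}"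
      "\<delta> \<in> cube k" using R unfolding routes_def by blast
    then show ?thesis using weighted_point_weight[OF s, of k t \<delta> h x] trop_min_le[of \<delta> k s h t x]
      by simp
  qed
  then have "{R \<in> routes s. weighted (point_weight s h x) h R = 0} \<subseteq> {R \<in> routes s. \<forall>Q\<in>routes s.
      weighted (point_weight s h x) h R \<le> weighted (point_weight s h x) h Q}"
    by auto
  then show ?thesis by (rule pairwise_subset[OF admissible_minimizers_coherent[OF adm]])
qed

lemma associated_point_weight:
  assumes s: "composition s" and w: "w \<in> stirling_perms s" and x: "associated_point s h w x"
    and R: "R \<in> Delta s w"
  shows "weighted (point_weight s h x) h R = 0"
proof -
  have "R \<in> routes s" using R Delta_subset_routes[OF w] by blast
  then obtain k t \<delta> where *: "R = route s k t \<delta>" "k \<in> {1..length s + 1}"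
    "t \<in> {1..comp_part s k - 1}" "\<delta> \<in> cube k"
    unfolding routes_def by blast
  have "\<delta> \<in> minimizers s h k t x"
  proof (cases "k = 1")
    \<comment> \<open>An associated point is constrained only for \<open>k\<close> at least 2. For
      \<open>k = 1\<close> the cube has a single element, which is a minimizer at every
      point.\<close>
    case True
    then show ?thesis using *(4) by (intro in_minimizersI) (auto simp: cube_def)
  next
    case False
    then have "k \<in> {2..length s + 1}" using *(2) by auto
    then show ?thesis using x R * unfolding associated_point_def by blast
  qed
  then show ?thesis using weighted_point_weight[OF s *(2-4)] *(1) by (simp add: minimizers_def)
qed

text \<open>On \<open>Delta s w\<close> the weighted height vanishes, so heights are negated route
  weights. The sum telescopes to the weight of the dip at \<open>a\<close> minus that of the bump,
  which is the coordinate.\<close>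

lemma associated_point_lookup:
  assumes s: "composition s" and w: "w \<in> stirling_perms s" and x: "associated_point s h w x"
    and a: "1 \<le> a" "a \<le> length s"
  shows "Poly_Mapping.lookup x a =
    (\<Sum>t=1..comp_part s a. h (prefix_route s (take (occ_prefix w a t) w))
                      - h (prefix_route s (take (occ_prefix w a t + 1) w)))"
proof -
  let ?\<omega> = "point_weight s h x"
  have pos: "0 < comp_part s a" by (rule comp_part_pos[OF s a])
  have h: "h (prefix_route s (take i w)) = - (\<Sum>e\<in>set (prefix_route s (take i w)). ?\<omega> e)"
    if "i \<le> sum_list s" for i
    using associated_point_weight[OF s w x, of "prefix_route s (take i w)"] that
    by (auto simp: Delta_def weighted_def)
  have "(\<Sum>t=1..comp_part s a. h (prefix_route s (take (occ_prefix w a t) w))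
                      - h (prefix_route s (take (occ_prefix w a t + 1) w)))
    = (\<Sum>t=1..comp_part s a. (\<Sum>e\<in>set (prefix_route s (take (occ_prefix w a t + 1) w)). ?\<omega> e)
      - (\<Sum>e\<in>set (prefix_route s (take (occ_prefix w a t) w)). ?\<omega> e))"
  proof (rule sum.cong[OF refl])
    fix t assume "t \<in> {1..comp_part s a}"
    then have "occ_prefix w a t < sum_list s"
      using occ_prefix(1)[of t w a] stirling_count[OF w a] length_stirling[OF w] by simp
    then show "h (prefix_route s (take (occ_prefix w a t) w))
        - h (prefix_route s (take (occ_prefix w a t + 1) w)) =
      (\<Sum>e\<in>set (prefix_route s (take (occ_prefix w a t + 1) w)). ?\<omega> e)
        - (\<Sum>e\<in>set (prefix_route s (take (occ_prefix w a t) w)). ?\<omega> e)"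
      using h[of "occ_prefix w a t"] h[of "occ_prefix w a t + 1"] by simp
  qed
  also have "\<dots> = ?\<omega> (a, comp_part s a) - ?\<omega> (a, 0)" by (rule telescoping_weights[OF w a pos])
  also have "\<dots> = Poly_Mapping.lookup x a" using pos by (simp add: point_weight_def)
  finally show ?thesis by simp
qed

lemma associated_point_unique:
  assumes "composition s" "w \<in> stirling_perms s" "associated_point s h w x" "associated_point s h w y"
  shows "x = y"
proof (rule poly_mapping_eqI)
  fix a
  show "Poly_Mapping.lookup x a = Poly_Mapping.lookup y a"
  proof (cases "a \<in> {1..length s}")
    case True
    then show ?thesis
      using associated_point_lookup[OF assms(1,2,3), of a] associated_point_lookup[OF assms(1,2,4), of a]
      by simp
  next
    case False
    then have "a \<notin> Poly_Mapping.keys x" "a \<notin> Poly_Mapping.keys y"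
      using assms(3,4) by (auto simp: associated_point_def Rn_def)
    then show ?thesis by (simp add: in_keys_iff)
  qed
qed

text \<open>Admissibility gives weights for which all routes of \<open>Delta s w\<close> are
  minimal, and the coordinates of \<open>x\<close> are dip weight minus bump weight. For fixed
  \<open>k\<close> and \<open>t\<close> the weighted height then differs from
  \<open>trop_term\<close> by a constant, so minimal routes yield minimizers.\<close>

lemma associated_point_exists:
  assumes adm: "admissible s h" and w: "w \<in> stirling_perms s"
  obtains x where "associated_point s h w x"
proof -
  obtain \<omega> where \<omega>: "\<And>R Q. R \<in> Delta s w \<Longrightarrow> Q \<in> routes s \<Longrightarrow> weighted \<omega> h R \<le> weighted \<omega> h Q"
    using admissible_weights[OF adm Delta_subset_routes[OF w] Delta_nonempty coherent_Delta[OF w]]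
    by blast
  define c where "c = (\<lambda>i. \<omega> (i, comp_part s i) - \<omega> (i, 0))"
  define x where "x = (\<Sum>i\<in>{1..length s}. Poly_Mapping.single i (c i))"
  have x: "Poly_Mapping.lookup x i = (if i \<in> {1..length s} then c i else 0)" for i
    by (simp add: x_def lookup_sum lookup_single when_def)
  have "x \<in> Rn (length s)" by (auto simp: Rn_def in_keys_iff x split: if_splits)
  moreover have "\<delta> \<in> minimizers s h k t x"
    if k: "k \<in> {2..length s + 1}" "t \<in> {1..comp_part s k - 1}" and \<delta>: "\<delta> \<in> cube k"
      and R: "route s k t \<delta> \<in> Delta s w" for k t \<delta>
  proof (rule in_minimizersI[OF \<delta>])
    fix \<epsilon> assume \<epsilon>: "\<epsilon> \<in> cube k"
    have val: "weighted \<omega> h (route s k t \<eta>) =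
        \<omega> (k, t) + (\<Sum>i\<in>{1..<k}. \<omega> (i, 0)) + trop_term s h k t x \<eta>" if \<eta>: "\<eta> \<in> cube k" for \<eta>
    proof -
      have "(\<Sum>i\<in>{1..<k}. \<omega> (i, \<eta> i * comp_part s i)) =
          (\<Sum>i\<in>{1..<k}. \<omega> (i, 0) + real (\<eta> i) * Poly_Mapping.lookup x i)"
      proof (rule sum.cong[OF refl])
        fix i assume i: "i \<in> {1..<k}"
        then have "\<eta> i = 0 \<or> \<eta> i = 1" using \<eta> by (auto simp: cube_def PiE_iff)
        then show "\<omega> (i, \<eta> i * comp_part s i) = \<omega> (i, 0) + real (\<eta> i) * Poly_Mapping.lookup x i"
          using i k by (auto simp: x c_def)
      qed
      then show ?thesis
        using route_weight[of k \<omega> s t \<eta>] k by (simp add: weighted_def trop_term_def sum.distrib)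
    qed
    have "route s k t \<epsilon> \<in> routes s" unfolding routes_def using k \<epsilon> by fastforce
    then show "trop_term s h k t x \<delta> \<le> trop_term s h k t x \<epsilon>"
      using \<omega>[OF R] val[OF \<delta>] val[OF \<epsilon>] by fastforce
  qed
  ultimately show ?thesis using that unfolding associated_point_def by blast
qed

section \<open>The bijection with the vertices of the bounded complex\<close>

lemma vertex_point_associated:
  assumes "composition s" "admissible s h" "w \<in> stirling_perms s"
  shows "associated_point s h w (vertex_point s h w)"
  unfolding vertex_point_def
  using associated_point_exists[OF assms(2,3)] associated_point_unique[OF assms(1,3)]
  by (metis (mono_tags, lifting) theI)

text \<open>If two words share their point, the routes of both simplices have weighted height 0
  there, so the union of the simplices is coherent.\<close>

lemma inj_on_vertex_point:
  assumes s: "composition s" and adm: "admissible s h"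
  shows "inj_on (vertex_point s h) (stirling_perms s)"
proof (rule inj_onI)
  fix w w' assume w: "w \<in> stirling_perms s" "w' \<in> stirling_perms s"
    and eq: "vertex_point s h w = vertex_point s h w'"
  let ?x = "vertex_point s h w"
  have "Delta s w \<union> Delta s w' \<subseteq> {R \<in> routes s. weighted (point_weight s h ?x) h R = 0}"
    using associated_point_weight[OF s w(1) vertex_point_associated[OF s adm w(1)]]
      associated_point_weight[OF s w(2) vertex_point_associated[OF s adm w(2)]]
      Delta_subset_routes[OF w(1)] Delta_subset_routes[OF w(2)]
    by (auto simp: eq)
  then have "pairwise (coherent s) (Delta s w \<union> Delta s w')"
    by (rule pairwise_subset[OF routes_minimizing_point_weight_coherent[OF s adm]])
  then show "w = w'" by (rule Delta_union_coherent_imp_eq[OF w])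
qed

text \<open>Minimizers at \<open>v(w)\<close> remain minimizers on its whole cell, so every point of
  the cell is associated to \<open>w\<close>, and uniqueness leaves a single point.\<close>

lemma vertex_point_is_vertex:
  assumes s: "composition s" and adm: "admissible s h" and w: "w \<in> stirling_perms s"
  shows "vertex_point s h w \<in> complex_vertices (bounded_complex s h)"
proof -
  let ?x = "vertex_point s h w"
  have x: "associated_point s h w ?x" by (rule vertex_point_associated[OF assms])
  then have Rn: "?x \<in> Rn (length s)" by (simp add: associated_point_def)
  have "y = ?x" if "y \<in> cell s h ?x" for y
  proof -
    have "associated_point s h w y"
      using that x unfolding associated_point_def cell_def by blast
    then show ?thesis using associated_point_unique[OF s w] x by blast
  qed
  then have "cell s h ?x = {?x}" using Rn by (auto simp: cell_def)
  then show ?thesis unfolding complex_vertices_def bounded_complex_def using Rn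
    by (metis (mono_tags, lifting) bounded_insert bounded_empty mem_Collect_eq)
qed

text \<open>The minimizing routes at the vertex form a coherent set, contained in some
  \<open>Delta s w\<close>. Hence they stay minimizing at \<open>v(w)\<close>, which puts
  \<open>v(w)\<close> into the one-point cell.\<close>

lemma vertex_is_vertex_point:
  assumes s: "composition s" and adm: "admissible s h"
    and p: "p \<in> complex_vertices (bounded_complex s h)"
  shows "p \<in> vertex_point s h ` stirling_perms s"
proof -
  obtain x where x: "x \<in> Rn (length s)" "cell s h x = {p}"
    using p unfolding complex_vertices_def bounded_complex_def by auto
  have "x \<in> cell s h x" using x(1) by (simp add: cell_def)
  then have xp: "x = p" using x(2) by simp
  let ?S = "{R \<in> routes s. weighted (point_weight s h x) h R = 0}"
  obtain w where w: "w \<in> stirling_perms s" "?S \<subseteq> Delta s w"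
    using coherent_subset_Delta[OF _ routes_minimizing_point_weight_coherent[OF s adm]] by blast
  let ?y = "vertex_point s h w"
  have y: "associated_point s h w ?y" by (rule vertex_point_associated[OF s adm w(1)])
  have "minimizers s h k t x \<subseteq> minimizers s h k t ?y"
    if k: "k \<in> {2..length s + 1}" "t \<in> {1..comp_part s k - 1}" for k t
  proof
    fix \<delta> assume \<delta>: "\<delta> \<in> minimizers s h k t x"
    then have c: "\<delta> \<in> cube k" by (simp add: minimizers_def)
    have k1: "k \<in> {1..length s + 1}" using k by auto
    have "weighted (point_weight s h x) h (route s k t \<delta>) = 0"
      using weighted_point_weight[OF s k1 k(2) c] \<delta> by (simp add: minimizers_def)
    moreover have "route s k t \<delta> \<in> routes s" unfolding routes_def using k1 k(2) c by blast
    ultimately have "route s k t \<delta> \<in> Delta s w" using w(2) by blast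
    then show "\<delta> \<in> minimizers s h k t ?y" using y k c unfolding associated_point_def by blast
  qed
  moreover have "?y \<in> Rn (length s)" using y by (simp add: associated_point_def)
  ultimately have "?y \<in> cell s h x" by (simp add: cell_def)
  then have "?y = p" using x(2) by simp
  then show ?thesis using w(1) by blast
qed

theorem theorem5p11:
  fixes s :: "nat list" and h :: "edge list \<Rightarrow> real"
  assumes "composition s"
    and "admissible s h"
  shows "(\<forall>w\<in>stirling_perms s. \<exists>!x. associated_point s h w x) \<and>
    bij_betw (vertex_point s h) (stirling_perms s) (complex_vertices (bounded_complex s h)) \<and>
    (\<forall>w\<in>stirling_perms s. \<forall>a\<in>{1..length s}.
      Poly_Mapping.lookup (vertex_point s h w) a =
        (\<Sum>t=1..comp_part s a. h (prefix_route s (take (occ_prefix w a t) w))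
                          - h (prefix_route s (take (occ_prefix w a t + 1) w))))"
proof (intro conjI ballI)
  fix w assume w: "w \<in> stirling_perms s"
  show "\<exists>!x. associated_point s h w x"
    using vertex_point_associated[OF assms w] associated_point_unique[OF assms(1) w] by blast
next
  show "bij_betw (vertex_point s h) (stirling_perms s) (complex_vertices (bounded_complex s h))"
    unfolding bij_betw_def
    using inj_on_vertex_point[OF assms] vertex_point_is_vertex[OF assms]
      vertex_is_vertex_point[OF assms] by blast
next
  fix w a assume w: "w \<in> stirling_perms s" and "a \<in> {1..length s}"
  then show "Poly_Mapping.lookup (vertex_point s h w) a =
      (\<Sum>t=1..comp_part s a. h (prefix_route s (take (occ_prefix w a t) w))
                        - h (prefix_route s (take (occ_prefix w a t + 1) w)))"
    using associated_point_lookup[OF assms(1) w vertex_point_associated[OF assms w], of a] by simp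
qed

end
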